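(* Let $X$ be a simple abelian variety over $\mathbb{C}$ such that $\mathrm{End}_{\mathbb{Q}}(X)$ is isomorphic to a totally real number field, a totally definite quaternion algebra, or a CM-field, and let $f$ be an endomorphism of $X$ with entropy $\log(\gamma)$. Then $\gamma$ is contained in the normal closure (over $\mathbb{Q}$, inside $\mathbb{C}$) of the maximal totally real subfield of $\mathrm{End}_{\mathbb{Q}}(X)$.
   Context: For an abelian variety $X$ over $\mathbb{C}$, $\mathrm{End}_{\mathbb{Q}}(X)=\mathrm{End}(X)\otimes_{\mathbb{Z}}\mathbb{Q}$. Entropy means topological entropy; for a surjective endomorphism $f$ of $X$ (on a simple $X$, every non-zero endomorphism is surjective) it equals $$\max_{1\le j\le\dim X}\log\rho\bigl(f^*:\mathrm{H}^{j,j}(X)\to\mathrm{H}^{j,j}(X)\bigr),$$ where $\rho$ denotes the spectral radius. A totally real number field is a number field $F$ with $\sigma(F)\subset\mathbb{R}$ for all embeddings $\sigma:F\hookrightarrow\mathbb{C}$ ($F=\mathbb{Q}$ is allowed). A CM-field is a totally imaginary quadratic extension of a totally real number field. A quaternion algebra $B$ over a totally real number field $F$ is totally definite if $B\otimes_\sigma\mathbb{R}\simeq\mathbb{H}$ for every embedding $\sigma:F\hookrightarrow\mathbb{R}$. The maximal totally real subfield of $\mathrm{End}_{\mathbb{Q}}(X)$ is the field itself if $\mathrm{End}_{\mathbb{Q}}(X)$ is totally real; the totally real subfield of index $2$ if it is a CM-field; and the center $F$ if it is a totally definite quaternion algebra over $F$. *)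

theory Defs
  imports
    "HOL-Analysis.Analysis"
    "HOL-Algebra.Algebra"
    "HOL-Algebra.Algebraic_Closure_Type"
    "HOL-Computational_Algebra.Computational_Algebra"
begin

section \<open>Topological entropy\<close>

text \<open>Entropy is taken in the sense of Adler, Konheim and McAndrew: it is defined by open covers and
  makes sense for any continuous self-map of a (nonempty) compact space.\<close>

definition open_cover :: "'a topology \<Rightarrow> 'a set set \<Rightarrow> bool" where
  "open_cover S \<U> \<longleftrightarrow> (\<forall>U\<in>\<U>. openin S U) \<and> \<Union>\<U> = topspace S"

definition subcover_number :: "'a topology \<Rightarrow> 'a set set \<Rightarrow> nat" where
  "subcover_number S \<U> = Inf {card \<V> |\<V>. \<V> \<subseteq> \<U> \<and> finite \<V> \<and> \<Union>\<V> = topspace S}"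

text \<open>The common refinement of the covers \<open>f\<^sup>-\<^sup>k \<U>\<close> for \<open>k < n\<close>.\<close>

definition iterated_join :: "'a topology \<Rightarrow> ('a \<Rightarrow> 'a) \<Rightarrow> 'a set set \<Rightarrow> nat \<Rightarrow> 'a set set" where
  "iterated_join S f \<U> n =
     {{x \<in> topspace S. \<forall>k<n. (f ^^ k) x \<in> u k} |u. \<forall>k<n. u k \<in> \<U>}"

text \<open>The limit over \<open>n\<close> exists by subadditivity, so \<open>limsup\<close> is the limit.\<close>

definition topological_entropy :: "'a topology \<Rightarrow> ('a \<Rightarrow> 'a) \<Rightarrow> ereal" where
  "topological_entropy S f =
     (SUP \<U> \<in> {\<U>. open_cover S \<U>}.
        limsup (\<lambda>n. ereal (ln (real (subcover_number S (iterated_join S f \<U> n))) / real n)))"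


section \<open>Complex tori and abelian varieties\<close>

definition lattice_in :: "'a::euclidean_space set \<Rightarrow> 'a set \<Rightarrow> bool" where
  "lattice_in W L \<longleftrightarrow>
     (\<exists>B. independent B \<and> span B = W \<and>
          L = range (\<lambda>c :: 'a \<Rightarrow> int. \<Sum>b\<in>B. real_of_int (c b) *\<^sub>R b))"

definition vector_group :: "'a::real_vector monoid" where
  "vector_group = \<lparr>carrier = UNIV, monoid.mult = (+), one = 0\<rparr>"

definition torus :: "'a::real_vector set \<Rightarrow> 'a set monoid" where
  "torus \<Lambda> = vector_group Mod \<Lambda>"

definition torus_proj :: "'a::real_vector set \<Rightarrow> 'a \<Rightarrow> 'a set" where
  "torus_proj \<Lambda> v = \<Lambda> #>\<^bsub>vector_group\<^esub> v"

definition torus_topology :: "'a::real_normed_vector set \<Rightarrow> 'a set topology" where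
  "torus_topology \<Lambda> = topology (\<lambda>U. U \<subseteq> carrier (torus \<Lambda>) \<and> open (torus_proj \<Lambda> -` U))"

text \<open>A polarization of \<open>\<complex>\<^sup>g / \<Lambda>\<close>, given by its Riemann form.\<close>

definition riemann_form ::
    "(complex ^ 'n) set \<Rightarrow> (complex ^ 'n \<Rightarrow> complex ^ 'n \<Rightarrow> complex) \<Rightarrow> bool" where
  "riemann_form \<Lambda> H \<longleftrightarrow>
     (\<forall>x y z. H (x + y) z = H x z + H y z) \<and>
     (\<forall>a x y. H (a *s x) y = a * H x y) \<and>
     (\<forall>x y. H y x = cnj (H x y)) \<and>
     (\<forall>x. x \<noteq> 0 \<longrightarrow> 0 < Re (H x x)) \<and>
     (\<forall>x\<in>\<Lambda>. \<forall>y\<in>\<Lambda>. Im (H x y) \<in> \<int>)"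

text \<open>\<open>abelian_variety \<Lambda>\<close> says that \<open>\<Lambda>\<close> is a lattice in \<open>\<complex>\<^sup>g\<close> (\<open>g = CARD('n) \<ge> 1\<close>) and the complex
  torus \<open>X = \<complex>\<^sup>g / \<Lambda>\<close> is polarizable. By the theorems of Riemann, Lefschetz and Chow, the positive-dimensional
  abelian varieties over the complex numbers are, up to isomorphism, exactly these tori.\<close>

definition abelian_variety :: "(complex ^ 'n) set \<Rightarrow> bool" where
  "abelian_variety \<Lambda> \<longleftrightarrow> lattice_in UNIV \<Lambda> \<and> (\<exists>H. riemann_form \<Lambda> H)"

text \<open>The abelian subvarieties of \<open>X\<close> are its complex subtori, i.e. the images of the complex subspaces
  \<open>W\<close> in which \<open>W \<inter> \<Lambda>\<close> is a lattice.\<close>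

definition simple_abelian_variety :: "(complex ^ 'n) set \<Rightarrow> bool" where
  "simple_abelian_variety \<Lambda> \<longleftrightarrow>
     abelian_variety \<Lambda> \<and>
     (\<forall>W. vec.subspace W \<and> lattice_in W (W \<inter> \<Lambda>) \<longrightarrow> W = {0} \<or> W = UNIV)"

text \<open>The projection is a covering map, so a map of the torus is holomorphic iff it is locally induced by
  holomorphic maps between open subsets of \<open>\<complex>\<^sup>g\<close>.\<close>

definition torus_holomorphic ::
    "(complex ^ 'n) set \<Rightarrow> ((complex ^ 'n) set \<Rightarrow> (complex ^ 'n) set) \<Rightarrow> bool" where
  "torus_holomorphic \<Lambda> f \<longleftrightarrow>
     (\<forall>v. \<exists>U F. open U \<and> v \<in> U \<and>
        (\<forall>w\<in>U. f (torus_proj \<Lambda> w) = torus_proj \<Lambda> (F w) \<and>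
                (\<exists>A :: complex ^ 'n ^ 'n. (F has_derivative (\<lambda>h. A *v h)) (at w))))"

definition torus_endomorphism ::
    "(complex ^ 'n) set \<Rightarrow> ((complex ^ 'n) set \<Rightarrow> (complex ^ 'n) set) \<Rightarrow> bool" where
  "torus_endomorphism \<Lambda> f \<longleftrightarrow> f \<in> hom (torus \<Lambda>) (torus \<Lambda>) \<and> torus_holomorphic \<Lambda> f"

text \<open>The image of \<open>End(X)\<close> under the (faithful) analytic representation; see
  \<open>torus_endomorphism_analytic_rep\<close> and \<open>analytic_rep_unique\<close> below.\<close>

definition End_torus :: "(complex ^ 'n) set \<Rightarrow> (complex ^ 'n ^ 'n) set" where
  "End_torus \<Lambda> =
     {A. \<exists>f. torus_endomorphism \<Lambda> f \<and> (\<forall>v. f (torus_proj \<Lambda> v) = torus_proj \<Lambda> (A *v v))}"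

text \<open>As \<open>End(X)\<close> is torsion-free, \<open>End(X) \<otimes> \<rat>\<close> is the ring of all \<open>A\<close> such that \<open>n A\<close> lies in
  \<open>End(X)\<close> for some \<open>n > 0\<close>.\<close>

definition End_Q :: "(complex ^ 'n) set \<Rightarrow> (complex ^ 'n ^ 'n) ring" where
  "End_Q \<Lambda> =
     \<lparr>carrier = {A. \<exists>n::nat. 0 < n \<and> real n *\<^sub>R A \<in> End_torus \<Lambda>},
      monoid.mult = (**), one = mat 1, ring.zero = 0, add = (+)\<rparr>"

lemma lattice_in_discrete:
  assumes "lattice_in W L"
  obtains e where "0 < e" "\<And>x. x \<in> L \<Longrightarrow> x \<noteq> 0 \<Longrightarrow> e \<le> norm x"
proof -
  obtain B where B: "independent B"
    and L: "L = range (\<lambda>c :: 'a \<Rightarrow> int. \<Sum>b\<in>B. real_of_int (c b) *\<^sub>R b)"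
    using assms by (auto simp: lattice_in_def)
  have fin: "finite B"
    using B by (rule independent_imp_finite)
  have "\<exists>g K. linear g \<and> (\<forall>b'\<in>B. g b' = (if b' = b then 1 else (0::real))) \<and> 0 < K \<and>
              (\<forall>x. \<bar>g x\<bar> \<le> norm x * K)" for b
  proof -
    obtain g where g: "linear g" "\<forall>b'\<in>B. g b' = (if b' = b then 1 else (0::real))"
      using linear_independent_extend[OF B, of "\<lambda>b'. if b' = b then 1 else 0"] by blast
    obtain K where "0 < K" "\<forall>x. norm (g x) \<le> norm x * K"
      using bounded_linear.pos_bounded[OF linear_conv_bounded_linear[THEN iffD1, OF g(1)]] by blast
    with g show ?thesis by auto
  qed
  then obtain g K where g: "\<And>b. linear (g b)"
      "\<And>b b'. b' \<in> B \<Longrightarrow> g b b' = (if b' = b then 1 else (0::real))"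
    and K: "\<And>b. 0 < K b" "\<And>b x. \<bar>g b x\<bar> \<le> norm x * K b"
    by metis
  define M where "M = 1 + sum K B"
  have "0 \<le> sum K B" using K(1) by (meson less_imp_le sum_nonneg)
  then have M: "0 < M" by (simp add: M_def)
  show ?thesis
  proof (rule that[of "1 / M"])
    show "0 < 1 / M" using M by simp
  next
    fix x assume "x \<in> L" "x \<noteq> 0"
    then obtain c :: "'a \<Rightarrow> int" where x: "x = (\<Sum>b\<in>B. real_of_int (c b) *\<^sub>R b)"
      by (auto simp: L)
    with \<open>x \<noteq> 0\<close> obtain b where b: "b \<in> B" "c b \<noteq> 0"
      by (metis (mono_tags, lifting) of_int_0 scale_zero_left sum.neutral)
    have "g b x = (\<Sum>b'\<in>B. real_of_int (c b') * g b b')"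
      unfolding x by (simp add: linear_sum[OF g(1)] linear_scale[OF g(1)])
    also have "\<dots> = (\<Sum>b'\<in>B. if b' = b then real_of_int (c b') else 0)"
      by (rule sum.cong) (auto simp: g(2))
    also have "\<dots> = real_of_int (c b)"
      using b fin by simp
    finally have "1 \<le> \<bar>g b x\<bar>"
      using b(2) by simp
    also have "\<dots> \<le> norm x * K b" by (rule K(2))
    also have "\<dots> \<le> norm x * M"
    proof -
      have "K b \<le> sum K B" using b fin K(1) by (simp add: member_le_sum less_imp_le)
      then show ?thesis by (intro mult_left_mono) (auto simp: M_def)
    qed
    finally show "1 / M \<le> norm x"
      using M by (simp add: field_simps)
  qed
qed

lemma lattice_in_subgroup:
  assumes "lattice_in W L"
  shows "0 \<in> L" "x \<in> L \<Longrightarrow> y \<in> L \<Longrightarrow> x + y \<in> L" "x \<in> L \<Longrightarrow> - x \<in> L"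
    "x \<in> L \<Longrightarrow> y \<in> L \<Longrightarrow> x - y \<in> L"
proof -
  obtain B where L: "L = range (\<lambda>c :: 'a \<Rightarrow> int. \<Sum>b\<in>B. real_of_int (c b) *\<^sub>R b)"
    using assms by (auto simp: lattice_in_def)
  show "0 \<in> L"
    unfolding L by (rule range_eqI[of _ _ "\<lambda>_. 0"]) simp
  show *: "x + y \<in> L" if "x \<in> L" "y \<in> L" for x y
  proof -
    obtain c where c: "x = (\<Sum>b\<in>B. real_of_int (c b) *\<^sub>R b)"
      using \<open>x \<in> L\<close> by (auto simp: L)
    obtain d where d: "y = (\<Sum>b\<in>B. real_of_int (d b) *\<^sub>R b)"
      using \<open>y \<in> L\<close> by (auto simp: L)
    from c d have cd: "x + y = (\<Sum>b\<in>B. real_of_int (c b) *\<^sub>R b) + (\<Sum>b\<in>B. real_of_int (d b) *\<^sub>R b)"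
      by simp
    show ?thesis
      unfolding L cd
      by (rule range_eqI[of _ _ "\<lambda>b. c b + d b"]) (simp add: scaleR_left_distrib sum.distrib)
  qed
  show **: "- x \<in> L" if "x \<in> L" for x
  proof -
    obtain c where c: "x = (\<Sum>b\<in>B. real_of_int (c b) *\<^sub>R b)"
      using \<open>x \<in> L\<close> by (auto simp: L)
    show ?thesis
      unfolding L c by (rule range_eqI[of _ _ "\<lambda>b. - c b"]) (simp add: sum_negf)
  qed
  show "x - y \<in> L" if "x \<in> L" "y \<in> L"
    using *[OF that(1) **[OF that(2)]] by simp
qed

lemma torus_proj_eq: "torus_proj \<Lambda> v = {l + v |l. l \<in> \<Lambda>}"
  by (auto simp: torus_proj_def r_coset_def vector_group_def)

lemma torus_proj_eq_iff:
  assumes "lattice_in W \<Lambda>"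
  shows "torus_proj \<Lambda> v = torus_proj \<Lambda> w \<longleftrightarrow> v - w \<in> \<Lambda>"
proof
  assume "torus_proj \<Lambda> v = torus_proj \<Lambda> w"
  moreover have "0 + v \<in> torus_proj \<Lambda> v"
    using lattice_in_subgroup(1)[OF assms] unfolding torus_proj_eq by blast
  ultimately obtain l where "l \<in> \<Lambda>" "0 + v = l + w"
    unfolding torus_proj_eq by blast
  then show "v - w \<in> \<Lambda>" by simp
next
  assume vw: "v - w \<in> \<Lambda>"
  show "torus_proj \<Lambda> v = torus_proj \<Lambda> w"
  proof (intro equalityI subsetI)
    fix x assume "x \<in> torus_proj \<Lambda> v"
    then obtain l where "l \<in> \<Lambda>" "x = l + v" by (auto simp: torus_proj_eq)
    then have "l + (v - w) \<in> \<Lambda>" "x = (l + (v - w)) + w"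
      using vw lattice_in_subgroup(2)[OF assms] by auto
    then show "x \<in> torus_proj \<Lambda> w" unfolding torus_proj_eq by blast
  next
    fix x assume "x \<in> torus_proj \<Lambda> w"
    then obtain l where "l \<in> \<Lambda>" "x = l + w" by (auto simp: torus_proj_eq)
    then have "l - (v - w) \<in> \<Lambda>" "x = (l - (v - w)) + v"
      using vw lattice_in_subgroup(4)[OF assms] by auto
    then show "x \<in> torus_proj \<Lambda> v" unfolding torus_proj_eq by blast
  qed
qed

lemma carrier_torus: "carrier (torus \<Lambda>) = range (torus_proj \<Lambda>)"
  by (auto simp: torus_def FactGroup_def RCOSETS_def torus_proj_def vector_group_def)

lemma torus_mult:
  assumes "lattice_in W \<Lambda>"
  shows "torus_proj \<Lambda> v \<otimes>\<^bsub>torus \<Lambda>\<^esub> torus_proj \<Lambda> w = torus_proj \<Lambda> (v + w)"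
proof -
  have "torus_proj \<Lambda> v \<otimes>\<^bsub>torus \<Lambda>\<^esub> torus_proj \<Lambda> w = {(l + v) + (m + w) |l m. l \<in> \<Lambda> \<and> m \<in> \<Lambda>}"
    by (auto simp: torus_def FactGroup_def set_mult_def vector_group_def torus_proj_eq)
  also have "\<dots> = torus_proj \<Lambda> (v + w)"
  proof (intro equalityI subsetI)
    fix x assume "x \<in> {(l + v) + (m + w) |l m. l \<in> \<Lambda> \<and> m \<in> \<Lambda>}"
    then obtain l m where lm: "l \<in> \<Lambda>" "m \<in> \<Lambda>" "x = (l + m) + (v + w)"
      by (auto simp: algebra_simps)
    then show "x \<in> torus_proj \<Lambda> (v + w)"
      using lattice_in_subgroup(2)[OF assms lm(1,2)] unfolding torus_proj_eq by blast
  next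
    fix x assume "x \<in> torus_proj \<Lambda> (v + w)"
    then obtain l where "l \<in> \<Lambda>" "x = (l + v) + (0 + w)"
      by (auto simp: torus_proj_eq algebra_simps)
    then show "x \<in> {(l + v) + (m + w) |l m. l \<in> \<Lambda> \<and> m \<in> \<Lambda>}"
      using lattice_in_subgroup(1)[OF assms] by blast
  qed
  finally show ?thesis .
qed

lemma openin_torus_topology:
  "openin (torus_topology \<Lambda>) U \<longleftrightarrow> U \<subseteq> carrier (torus \<Lambda>) \<and> open (torus_proj \<Lambda> -` U)"
proof -
  have "istopology (\<lambda>U. U \<subseteq> carrier (torus \<Lambda>) \<and> open (torus_proj \<Lambda> -` U))"
    unfolding istopology_def by (auto simp: vimage_Union)
  then show ?thesis
    by (simp add: torus_topology_def)
qed

lemma topspace_torus_topology: "topspace (torus_topology \<Lambda>) = carrier (torus \<Lambda>)"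
proof (rule antisym)
  show "topspace (torus_topology \<Lambda>) \<subseteq> carrier (torus \<Lambda>)"
    using openin_torus_topology[of \<Lambda> "topspace (torus_topology \<Lambda>)"] by auto
  have "torus_proj \<Lambda> -` carrier (torus \<Lambda>) = UNIV"
    by (auto simp: carrier_torus)
  then show "carrier (torus \<Lambda>) \<subseteq> topspace (torus_topology \<Lambda>)"
    by (intro openin_subset) (simp add: openin_torus_topology)
qed

lemma matrix_vector_scaleR_left: "(c *\<^sub>R A) *v x = c *\<^sub>R (A *v (x :: complex ^ 'n))"
  by (simp add: vec_eq_iff matrix_vector_mult_def scaleR_sum_right)

lemma matrix_vector_scaleR_right: "A *v (c *\<^sub>R x) = c *\<^sub>R (A *v (x :: complex ^ 'n))"
  by (simp add: vec_eq_iff matrix_vector_mult_def scaleR_sum_right)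

lemma linear_matrix_vector: "linear (\<lambda>x :: complex ^ 'n. A *v x)"
  by (intro linearI) (simp_all add: matrix_vector_right_distrib matrix_vector_scaleR_right)

lemma bounded_linear_matrix_vector: "bounded_linear (\<lambda>x :: complex ^ 'n. A *v x)"
  using linear_matrix_vector linear_conv_bounded_linear by blast

lemma torus_endomorphism_analytic_rep:
  fixes \<Lambda> :: "(complex ^ 'n) set"
  assumes \<Lambda>: "lattice_in UNIV \<Lambda>" and f: "torus_endomorphism \<Lambda> f"
  shows "\<exists>A :: complex ^ 'n ^ 'n. \<forall>v. f (torus_proj \<Lambda> v) = torus_proj \<Lambda> (A *v v)"
proof -
  note sub = lattice_in_subgroup[OF \<Lambda>]
  note peq = torus_proj_eq_iff[OF \<Lambda>]
  obtain e where e: "0 < e" "\<And>x. x \<in> \<Lambda> \<Longrightarrow> x \<noteq> 0 \<Longrightarrow> e \<le> norm x"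
    using lattice_in_discrete[OF \<Lambda>] by blast
  have hom: "\<exists>u. f (torus_proj \<Lambda> v) = torus_proj \<Lambda> u" for v
    using f unfolding torus_endomorphism_def hom_def carrier_torus Pi_def by blast
  have add: "f (torus_proj \<Lambda> (v + w)) = torus_proj \<Lambda> (v' + w')"
    if "f (torus_proj \<Lambda> v) = torus_proj \<Lambda> v'" "f (torus_proj \<Lambda> w) = torus_proj \<Lambda> w'" for v w v' w'
    using f that by (auto simp: torus_endomorphism_def hom_def carrier_torus
        torus_mult[OF \<Lambda>, symmetric])
  obtain U F where U: "open U" "0 \<in> U" and F: "\<And>w. w \<in> U \<Longrightarrow> f (torus_proj \<Lambda> w) = torus_proj \<Lambda> (F w)"
    and dF: "\<And>w. w \<in> U \<Longrightarrow> \<exists>A :: complex ^ 'n ^ 'n. (F has_derivative (\<lambda>h. A *v h)) (at w)"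
    using f unfolding torus_endomorphism_def torus_holomorphic_def by metis
  obtain A :: "complex ^ 'n ^ 'n" where A: "(F has_derivative (\<lambda>h. A *v h)) (at 0)"
    using dF[OF U(2)] by blast
  obtain r where r: "0 < r" "ball 0 r \<subseteq> U"
    using U by (meson open_contains_ball)
  have F0: "F 0 \<in> \<Lambda>"
  proof -
    have "torus_proj \<Lambda> (F 0 + F 0) = torus_proj \<Lambda> (F 0)"
      using add[OF F[OF U(2)] F[OF U(2)]] F[OF U(2)] by simp
    then show ?thesis by (simp add: peq)
  qed
  define G where "G w = F w - F 0" for w
  have G: "f (torus_proj \<Lambda> w) = torus_proj \<Lambda> (G w)" if "w \<in> ball 0 r" for w
  proof -
    have "torus_proj \<Lambda> (F w) = torus_proj \<Lambda> (G w)"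
      using F0 by (simp add: peq G_def)
    then show ?thesis using F[of w] r(2) that by auto
  qed
  have contF: "continuous_on (ball 0 r) F"
    by (intro continuous_at_imp_continuous_on ballI)
       (use dF r(2) has_derivative_continuous in blast)
  then have contG: "continuous_on (ball 0 r) G"
    unfolding G_def by (intro continuous_intros)
  have addG: "G (x + y) = G x + G y" if xy: "norm x < r / 2" "norm y < r / 2" for x y
  proof -
    define P where "P t = G (t *\<^sub>R x + t *\<^sub>R y) - G (t *\<^sub>R x) - G (t *\<^sub>R y)" for t :: real
    have small: "t *\<^sub>R x \<in> ball 0 r" "t *\<^sub>R y \<in> ball 0 r" "t *\<^sub>R x + t *\<^sub>R y \<in> ball 0 r"
      if "t \<in> {0..1}" for t
    proof -
      have "norm (t *\<^sub>R x) \<le> norm x" "norm (t *\<^sub>R y) \<le> norm y"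
        using that by (auto simp: mult_left_le_one_le)
      then show "t *\<^sub>R x \<in> ball 0 r" "t *\<^sub>R y \<in> ball 0 r" "t *\<^sub>R x + t *\<^sub>R y \<in> ball 0 r"
        using xy norm_triangle_ineq[of "t *\<^sub>R x" "t *\<^sub>R y"] r(1) unfolding mem_ball_0 by linarith+
    qed
    have cont: "continuous_on {0..1} P"
      unfolding P_def using small
      by (intro continuous_intros continuous_on_compose2[OF contG]) auto
    have lat: "P t \<in> \<Lambda>" if "t \<in> {0..1}" for t
    proof -
      have "torus_proj \<Lambda> (G (t *\<^sub>R x + t *\<^sub>R y)) = torus_proj \<Lambda> (G (t *\<^sub>R x) + G (t *\<^sub>R y))"
        using add[OF G[OF small(1)[OF that]] G[OF small(2)[OF that]]] G[OF small(3)[OF that]] by simp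
      then show ?thesis by (simp add: peq P_def algebra_simps)
    qed
    have P0: "P 0 = 0"
      by (simp add: P_def G_def)
    have "P 1 = 0"
    proof (rule ccontr)
      assume "P 1 \<noteq> 0"
      then have "e \<le> norm (P 1)"
        using e(2) lat by simp
      then obtain t where t: "t \<in> {0..1}" "norm (P t) = e / 2"
        using IVT'[of "\<lambda>t. norm (P t)" 0 "e / 2" 1] e(1) P0 continuous_on_norm[OF cont] by auto
      then have "P t \<noteq> 0"
        using e(1) by auto
      then show False
        using e lat[OF t(1)] t(2) by fastforce
    qed
    then show ?thesis
      by (simp add: P_def G_def algebra_simps)
  qed
  have dG: "(G has_derivative (\<lambda>h. A *v h)) (at 0)"
    unfolding G_def using has_derivative_diff[OF A has_derivative_const[of "F 0"]] by simp
  have GA: "G x = A *v x" if x: "norm x < r / 2" for x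
  proof (cases "x = 0")
    case False
    have scale: "G (of_nat k *\<^sub>R (x /\<^sub>R of_nat n)) = of_nat k *\<^sub>R G (x /\<^sub>R of_nat n)" if "k \<le> n" "0 < n" for k n
      using that
    proof (induction k)
      case 0
      then show ?case by (simp add: G_def)
    next
      case (Suc k)
      have le: "norm (c *\<^sub>R x) < r / 2" if "0 \<le> c" "c \<le> 1" for c
        using that x mult_left_le_one_le[of "norm x" c] by simp
      have "G (of_nat k *\<^sub>R (x /\<^sub>R of_nat n) + x /\<^sub>R of_nat n) = G (of_nat k *\<^sub>R (x /\<^sub>R of_nat n)) + G (x /\<^sub>R of_nat n)"
      proof (rule addG)
        show "norm (of_nat k *\<^sub>R (x /\<^sub>R of_nat n)) < r / 2"
          using le[of "real k / real n"] Suc.prems by (simp add: divide_simps)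
        show "norm (x /\<^sub>R of_nat n) < r / 2"
          using le[of "1 / real n"] Suc.prems by (simp add: divide_simps)
      qed
      moreover have "of_nat (Suc k) *\<^sub>R (x /\<^sub>R of_nat n) = of_nat k *\<^sub>R (x /\<^sub>R of_nat n) + x /\<^sub>R of_nat n"
        by (simp add: algebra_simps)
      ultimately show ?case
        using Suc by (simp add: scaleR_left_distrib add.commute del: scaleR_scaleR)
    qed
    have "((\<lambda>h. norm (G h - G 0 - A *v h) / norm h) \<longlongrightarrow> 0) (at 0)"
      using dG unfolding has_derivative_at by simp
    then have "((\<lambda>h. norm (G h - A *v h) / norm h) \<longlongrightarrow> 0) (at 0)"
      by (simp add: G_def)
    moreover have "filterlim (\<lambda>n. x /\<^sub>R of_nat (Suc n)) (at 0) sequentially"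
    proof (rule filterlim_atI)
      show "(\<lambda>n. x /\<^sub>R of_nat (Suc n)) \<longlonglongrightarrow> 0"
        using tendsto_scaleR[OF LIMSEQ_inverse_real_of_nat tendsto_const[of x]] by simp
    qed (use False in simp)
    ultimately have "(\<lambda>n. norm (G (x /\<^sub>R of_nat (Suc n)) - A *v (x /\<^sub>R of_nat (Suc n))) / norm (x /\<^sub>R of_nat (Suc n))) \<longlonglongrightarrow> 0"
      by (rule filterlim_compose)
    moreover have "norm (G (x /\<^sub>R of_nat (Suc n)) - A *v (x /\<^sub>R of_nat (Suc n))) / norm (x /\<^sub>R of_nat (Suc n))
        = norm (G x - A *v x) / norm x" for n
    proof -
      define m where "m = real (Suc n)"
      have m: "0 < m" by (simp add: m_def)
      have "G x = m *\<^sub>R G (x /\<^sub>R m)"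
        using scale[of "Suc n" "Suc n"] m by (simp add: m_def)
      then have "G (x /\<^sub>R m) - A *v (x /\<^sub>R m) = (G x - A *v x) /\<^sub>R m"
        using m by (simp add: matrix_vector_scaleR_right scaleR_right_diff_distrib)
      then show ?thesis
        using m by (simp add: m_def)
    qed
    ultimately have "(\<lambda>n. norm (G x - A *v x) / norm x) \<longlonglongrightarrow> 0" by simp
    then have "norm (G x - A *v x) / norm x = 0"
      by (simp add: LIMSEQ_const_iff)
    with False show ?thesis by simp
  qed (simp add: G_def)
  have "f (torus_proj \<Lambda> v) = torus_proj \<Lambda> (A *v v)" for v
  proof -
    obtain n :: nat where n: "norm v / (r / 2) < real n"
      using reals_Archimedean2 by blast
    have n0: "0 < real n"
      using le_less_trans[OF _ n, of 0] r(1) by simp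
    define u where "u = v /\<^sub>R real n"
    have u: "norm u < r / 2"
      using n n0 r(1) by (simp add: u_def field_simps)
    have "f (torus_proj \<Lambda> (real k *\<^sub>R u)) = torus_proj \<Lambda> (real k *\<^sub>R (A *v u))" for k
    proof (induction k)
      case 0
      show ?case using G[of 0] r(1) by (simp add: G_def)
    next
      case (Suc k)
      have "f (torus_proj \<Lambda> u) = torus_proj \<Lambda> (A *v u)"
        using G[of u] GA[OF u] u r(1) by simp
      from add[OF Suc this] show ?case by (simp add: scaleR_left_distrib add.commute)
    qed
    from this[of n] show ?thesis
      using n0 by (simp add: u_def matrix_vector_scaleR_right)
  qed
  then show ?thesis by blast
qed

lemma analytic_rep_unique:
  fixes A A' :: "complex ^ 'n ^ 'n"
  assumes \<Lambda>: "lattice_in UNIV \<Lambda>"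
    and eq: "\<And>v. torus_proj \<Lambda> (A *v v) = torus_proj \<Lambda> (A' *v v)"
  shows "A = A'"
proof -
  obtain e where e: "0 < e" "\<And>x. x \<in> \<Lambda> \<Longrightarrow> x \<noteq> 0 \<Longrightarrow> e \<le> norm x"
    using lattice_in_discrete[OF \<Lambda>] by blast
  have "A *v v = A' *v v" for v
  proof (rule ccontr)
    define d where "d = A *v v - A' *v v"
    assume "A *v v \<noteq> A' *v v"
    then have d: "d \<noteq> 0" by (simp add: d_def)
    define c where "c = e / (2 * norm d)"
    have c: "0 < c" using e(1) d by (simp add: c_def)
    have "c *\<^sub>R d \<in> \<Lambda>"
      using eq[of "c *\<^sub>R v"]
      by (simp add: torus_proj_eq_iff[OF \<Lambda>] matrix_vector_scaleR_right d_def scaleR_right_diff_distrib)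
    then have "e \<le> norm (c *\<^sub>R d)" using c d by (intro e(2)) auto
    then show False using e(1) d by (simp add: c_def)
  qed
  then show ?thesis by (simp add: matrix_eq)
qed

lemma End_torus_iff:
  fixes A :: "complex ^ 'n ^ 'n"
  assumes \<Lambda>: "lattice_in UNIV \<Lambda>"
  shows "A \<in> End_torus \<Lambda> \<longleftrightarrow> (\<forall>l\<in>\<Lambda>. A *v l \<in> \<Lambda>)"
proof
  assume "A \<in> End_torus \<Lambda>"
  then obtain f where f: "\<And>v. f (torus_proj \<Lambda> v) = torus_proj \<Lambda> (A *v v)"
    by (auto simp: End_torus_def)
  show "\<forall>l\<in>\<Lambda>. A *v l \<in> \<Lambda>"
  proof
    fix l assume "l \<in> \<Lambda>"
    then have "torus_proj \<Lambda> l = torus_proj \<Lambda> 0" by (simp add: torus_proj_eq_iff[OF \<Lambda>])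
    then have "torus_proj \<Lambda> (A *v l) = torus_proj \<Lambda> 0" using f[of l] f[of 0] by simp
    then show "A *v l \<in> \<Lambda>" by (simp add: torus_proj_eq_iff[OF \<Lambda>])
  qed
next
  assume A: "\<forall>l\<in>\<Lambda>. A *v l \<in> \<Lambda>"
  define f where "f p = torus_proj \<Lambda> (A *v (SOME v. p = torus_proj \<Lambda> v))" for p
  have f: "f (torus_proj \<Lambda> v) = torus_proj \<Lambda> (A *v v)" for v
  proof -
    define w where "w = (SOME w. torus_proj \<Lambda> v = torus_proj \<Lambda> w)"
    have "torus_proj \<Lambda> v = torus_proj \<Lambda> w"
      unfolding w_def by (rule someI) (rule refl)
    then have "w - v \<in> \<Lambda>" using torus_proj_eq_iff[OF \<Lambda>] by metis
    then have "A *v w - A *v v \<in> \<Lambda>"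
      using A by (metis matrix_vector_mult_diff_distrib)
    then have "torus_proj \<Lambda> (A *v w) = torus_proj \<Lambda> (A *v v)"
      by (simp add: torus_proj_eq_iff[OF \<Lambda>])
    then show ?thesis
      by (simp add: f_def w_def)
  qed
  have "f \<in> hom (torus \<Lambda>) (torus \<Lambda>)"
    by (auto simp: hom_def carrier_torus f torus_mult[OF \<Lambda>] matrix_vector_right_distrib)
  moreover have "torus_holomorphic \<Lambda> f"
    unfolding torus_holomorphic_def
    by (intro allI exI[of _ UNIV] exI[of _ "\<lambda>v. A *v v"])
       (auto simp: f intro!: exI[of _ A] bounded_linear_imp_has_derivative bounded_linear_matrix_vector)
  ultimately show "A \<in> End_torus \<Lambda>"
    using f by (auto simp: End_torus_def torus_endomorphism_def)
qed


section \<open>Number fields and quaternion algebras\<close>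

definition number_field :: "'a ring \<Rightarrow> bool" where
  "number_field K \<longleftrightarrow>
     Ring.field K \<and>
     (\<exists>Q. subfield Q K \<and> K\<lparr>carrier := Q\<rparr> \<simeq> (ring_of_type_algebra :: rat ring) \<and>
          ring.finite_dimension K Q (carrier K))"

definition complex_embeddings :: "'a ring \<Rightarrow> ('a \<Rightarrow> complex) set" where
  "complex_embeddings K = ring_hom K (ring_of_type_algebra :: complex ring)"

definition real_embeddings :: "'a ring \<Rightarrow> ('a \<Rightarrow> real) set" where
  "real_embeddings K = ring_hom K (ring_of_type_algebra :: real ring)"

definition totally_real_field :: "'a ring \<Rightarrow> bool" where
  "totally_real_field K \<longleftrightarrow>
     number_field K \<and> (\<forall>\<sigma>\<in>complex_embeddings K. \<sigma> ` carrier K \<subseteq> \<real>)"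

definition totally_imaginary_field :: "'a ring \<Rightarrow> bool" where
  "totally_imaginary_field K \<longleftrightarrow>
     number_field K \<and> (\<forall>\<sigma>\<in>complex_embeddings K. \<not> \<sigma> ` carrier K \<subseteq> \<real>)"

definition CM_field_over :: "'a set \<Rightarrow> 'a ring \<Rightarrow> bool" where
  "CM_field_over F K \<longleftrightarrow>
     totally_imaginary_field K \<and> subfield F K \<and> totally_real_field (K\<lparr>carrier := F\<rparr>) \<and>
     ring.dimension K 2 F (carrier K)"

text \<open>The quaternion algebra \<open>(a, b)\<close> over \<open>F\<close>: the quadruple \<open>(x0, x1, x2, x3)\<close> stands for
  \<open>x0 + x1 i + x2 j + x3 k\<close>, where \<open>i\<^sup>2 = a\<close>, \<open>j\<^sup>2 = b\<close> and \<open>k = i j = - j i\<close>.\<close>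

fun quaternion_mult ::
    "'a ring \<Rightarrow> 'a \<Rightarrow> 'a \<Rightarrow> 'a \<times> 'a \<times> 'a \<times> 'a \<Rightarrow> 'a \<times> 'a \<times> 'a \<times> 'a \<Rightarrow> 'a \<times> 'a \<times> 'a \<times> 'a"
where
  "quaternion_mult F a b (x0, x1, x2, x3) (y0, y1, y2, y3) =
    (((x0 \<otimes>\<^bsub>F\<^esub> y0 \<oplus>\<^bsub>F\<^esub> a \<otimes>\<^bsub>F\<^esub> (x1 \<otimes>\<^bsub>F\<^esub> y1)) \<oplus>\<^bsub>F\<^esub> b \<otimes>\<^bsub>F\<^esub> (x2 \<otimes>\<^bsub>F\<^esub> y2))
        \<ominus>\<^bsub>F\<^esub> a \<otimes>\<^bsub>F\<^esub> b \<otimes>\<^bsub>F\<^esub> (x3 \<otimes>\<^bsub>F\<^esub> y3),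
     ((x0 \<otimes>\<^bsub>F\<^esub> y1 \<oplus>\<^bsub>F\<^esub> x1 \<otimes>\<^bsub>F\<^esub> y0) \<oplus>\<^bsub>F\<^esub> b \<otimes>\<^bsub>F\<^esub> (x3 \<otimes>\<^bsub>F\<^esub> y2)) \<ominus>\<^bsub>F\<^esub> b \<otimes>\<^bsub>F\<^esub> (x2 \<otimes>\<^bsub>F\<^esub> y3),
     ((x0 \<otimes>\<^bsub>F\<^esub> y2 \<oplus>\<^bsub>F\<^esub> x2 \<otimes>\<^bsub>F\<^esub> y0) \<oplus>\<^bsub>F\<^esub> a \<otimes>\<^bsub>F\<^esub> (x1 \<otimes>\<^bsub>F\<^esub> y3)) \<ominus>\<^bsub>F\<^esub> a \<otimes>\<^bsub>F\<^esub> (x3 \<otimes>\<^bsub>F\<^esub> y1),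
     ((x0 \<otimes>\<^bsub>F\<^esub> y3 \<oplus>\<^bsub>F\<^esub> x3 \<otimes>\<^bsub>F\<^esub> y0) \<oplus>\<^bsub>F\<^esub> x1 \<otimes>\<^bsub>F\<^esub> y2) \<ominus>\<^bsub>F\<^esub> x2 \<otimes>\<^bsub>F\<^esub> y1)"

fun quaternion_add ::
    "'a ring \<Rightarrow> 'a \<times> 'a \<times> 'a \<times> 'a \<Rightarrow> 'a \<times> 'a \<times> 'a \<times> 'a \<Rightarrow> 'a \<times> 'a \<times> 'a \<times> 'a" where
  "quaternion_add F (x0, x1, x2, x3) (y0, y1, y2, y3) =
     (x0 \<oplus>\<^bsub>F\<^esub> y0, x1 \<oplus>\<^bsub>F\<^esub> y1, x2 \<oplus>\<^bsub>F\<^esub> y2, x3 \<oplus>\<^bsub>F\<^esub> y3)"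

definition quaternion_algebra :: "'a ring \<Rightarrow> 'a \<Rightarrow> 'a \<Rightarrow> ('a \<times> 'a \<times> 'a \<times> 'a) ring" where
  "quaternion_algebra F a b =
     \<lparr>carrier = carrier F \<times> carrier F \<times> carrier F \<times> carrier F,
      monoid.mult = quaternion_mult F a b, one = (\<one>\<^bsub>F\<^esub>, \<zero>\<^bsub>F\<^esub>, \<zero>\<^bsub>F\<^esub>, \<zero>\<^bsub>F\<^esub>),
      ring.zero = (\<zero>\<^bsub>F\<^esub>, \<zero>\<^bsub>F\<^esub>, \<zero>\<^bsub>F\<^esub>, \<zero>\<^bsub>F\<^esub>), add = quaternion_add F\<rparr>"

abbreviation hamilton_quaternions :: "(real \<times> real \<times> real \<times> real) ring" where
  "hamilton_quaternions \<equiv> quaternion_algebra ring_of_type_algebra (- 1) (- 1)"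

text \<open>\<open>B\<close> is a totally definite quaternion algebra over its subfield \<open>F\<close> (which is then the center of
  \<open>B\<close>). If \<open>B\<close> is \<open>(a, b)\<close> over \<open>F\<close>, then its base change \<open>B \<otimes>\<^sub>\<sigma> \<real>\<close> is \<open>(\<sigma> a, \<sigma> b)\<close> over \<open>\<real>\<close>. A ring
  isomorphism of the latter with the Hamilton quaternions is automatically \<open>\<real>\<close>-linear, because the
  field \<open>\<real>\<close> has no nontrivial automorphisms.\<close>

definition totally_definite_quaternion_algebra_over :: "'a set \<Rightarrow> 'a ring \<Rightarrow> bool" where
  "totally_definite_quaternion_algebra_over F B \<longleftrightarrow>
     ring B \<and> subfield F B \<and> totally_real_field (B\<lparr>carrier := F\<rparr>) \<and>
     (\<exists>a\<in>F - {\<zero>\<^bsub>B\<^esub>}. \<exists>b\<in>F - {\<zero>\<^bsub>B\<^esub>}.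
        (\<exists>h\<in>ring_iso B (quaternion_algebra (B\<lparr>carrier := F\<rparr>) a b).
           \<forall>c\<in>F. h c = (c, \<zero>\<^bsub>B\<^esub>, \<zero>\<^bsub>B\<^esub>, \<zero>\<^bsub>B\<^esub>)) \<and>
        (\<forall>\<sigma>\<in>real_embeddings (B\<lparr>carrier := F\<rparr>).
           quaternion_algebra ring_of_type_algebra (\<sigma> a) (\<sigma> b) \<simeq> hamilton_quaternions))"

definition maximal_totally_real_subfield :: "'a ring \<Rightarrow> 'a set \<Rightarrow> bool" where
  "maximal_totally_real_subfield E F \<longleftrightarrow>
     totally_real_field E \<and> F = carrier E \<or>
     CM_field_over F E \<or>
     totally_definite_quaternion_algebra_over F E"


section \<open>Normal closure inside the complex numbers\<close>

definition normal_over_rat :: "complex set \<Rightarrow> bool" where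
  "normal_over_rat L \<longleftrightarrow>
     subfield L ring_of_type_algebra \<and> (\<forall>x\<in>L. algebraic x) \<and>
     (\<forall>p :: rat poly. Factorial_Ring.irreducible p \<and> (\<exists>x\<in>L. poly (map_poly of_rat p) x = 0) \<longrightarrow>
        (\<exists>c as. set as \<subseteq> L \<and> map_poly of_rat p = Polynomial.smult c (\<Prod>a\<leftarrow>as. [:- a, 1:])))"

text \<open>The smallest normal extension of \<open>\<rat>\<close> in \<open>\<complex>\<close> containing a copy of the number field \<open>K\<close>; as a normal
  extension contains all conjugates of \<open>K\<close> once it contains one, it does not depend on an embedding.\<close>

definition normal_closure :: "'a ring \<Rightarrow> complex set" where
  "normal_closure K =
     \<Inter> {L. normal_over_rat L \<and> (\<exists>\<sigma>\<in>complex_embeddings K. \<sigma> ` carrier K \<subseteq> L)}"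

end

theory Submission
  imports Defs
begin

text \<open>Let \<open>A\<close> be the analytic representation of \<open>f\<close>. It is annihilated by an irreducible rational
  polynomial: rational relations between the vectors \<open>A\<^sup>k l\<close>, \<open>l \<in> \<Lambda>\<close>, exist because the rational span
  of the lattice has finite dimension, and \<open>End\<^sub>\<rat>(X)\<close> is a division ring. Hence \<open>A\<close> is
  diagonalizable, and counting grid points in eigencoordinates gives the entropy
  \<open>\<Sum>\<^sub>i 2 log max(1, \<bar>\<alpha>\<^sub>i\<bar>)\<close>, so that \<open>\<gamma> = \<Prod>\<^sub>i max(1, \<bar>\<alpha>\<^sub>i\<bar>\<^sup>2)\<close>. A common eigenvector of a commutative
  subring of \<open>End\<^sub>\<rat>(X)\<close> defines a ring homomorphism to \<open>\<complex>\<close>; in this way an eigenvalue \<open>\<alpha>\<close> of \<open>A\<close>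
  extends an embedding \<open>\<sigma>\<close> of \<open>F\<close>. Since \<open>A\<close> is quadratic over \<open>F\<close>, with a nonreal root or a nonpositive
  discriminant at \<open>\<sigma>\<close>, \<open>\<bar>\<alpha>\<bar>\<^sup>2\<close> is the \<open>\<sigma>\<close>-image of an element of \<open>F\<close> (or \<open>\<bar>\<alpha>\<bar>\<^sup>2 = \<sigma>(A\<^sup>2)\<close> if \<open>A \<in> F\<close>). Thus it
  lies in the normal closure of \<open>F\<close>.\<close>

section \<open>Entropy of diagonalizable torus endomorphisms\<close>

text \<open>The exponent 2 in each factor of \<gamma> arises because a complex eigendirection
  consists of two real ones, both stretched by the absolute value of the eigenvalue.
  Diagonalizability comes from irreducibility, since an irreducible rational polynomial q has simple
  complex roots. The division property is used in the form that a nonzero ring element kills no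
  nonzero vector: if q(A) w = 0 for a single nonzero w, then q(A) = 0.

  An embedding \<sigma> of F and an element m of F with \<sigma> m equal to the absolute square are
  found separately for each eigenvalue, and \<sigma> need not be the embedding \<tau> that places F
  in a given normal field L. The link is that \<sigma> m and \<tau> m are roots of one irreducible
  rational polynomial, which splits in L once L contains a root. So every factor of \<gamma> lies in
  L by itself, without bookkeeping of multiplicities or conjugates.

  A noncommutative quaternion algebra has no common eigenvector for all its elements; there one is
  taken for F and A only, and the quadratic equation of A is evaluated on it.\<close>

lemma vimage_torus_proj_image:
  assumes "lattice_in W \<Lambda>"
  shows "torus_proj \<Lambda> -` (torus_proj \<Lambda> ` S) = (\<Union>l\<in>\<Lambda>. (+) l ` S)"
proof (intro equalityI subsetI)
  fix v assume "v \<in> torus_proj \<Lambda> -` (torus_proj \<Lambda> ` S)"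
  then obtain s where "s \<in> S" "v - s \<in> \<Lambda>" "v = (v - s) + s"
    using torus_proj_eq_iff[OF assms] by auto
  then show "v \<in> (\<Union>l\<in>\<Lambda>. (+) l ` S)" by blast
next
  fix v assume "v \<in> (\<Union>l\<in>\<Lambda>. (+) l ` S)"
  then obtain l s where "s \<in> S" "l \<in> \<Lambda>" "v = l + s" by blast
  then have "torus_proj \<Lambda> v = torus_proj \<Lambda> s" by (simp add: torus_proj_eq_iff[OF assms])
  with \<open>s \<in> S\<close> show "v \<in> torus_proj \<Lambda> -` (torus_proj \<Lambda> ` S)" by auto
qed

lemma openin_torus_proj_image:
  assumes "lattice_in W \<Lambda>" "open S"
  shows "openin (torus_topology \<Lambda>) (torus_proj \<Lambda> ` S)"
  unfolding openin_torus_topology carrier_torus vimage_torus_proj_image[OF assms(1)]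
  using assms(2) by (auto intro: open_translation)

text \<open>Rounding lattice coordinates down moves every point into the fundamental parallelepiped,
  where norms are at most the sum of the norms of the basis vectors.\<close>

lemma lattice_bounded_representative:
  assumes "lattice_in UNIV \<Lambda>"
  obtains R where "\<And>v. \<exists>w. norm w \<le> R \<and> torus_proj \<Lambda> w = torus_proj \<Lambda> v"
proof -
  obtain B where B: "independent B" "span B = UNIV"
    and L: "\<Lambda> = range (\<lambda>c :: 'a \<Rightarrow> int. \<Sum>b\<in>B. real_of_int (c b) *\<^sub>R b)"
    using assms by (auto simp: lattice_in_def)
  have fin: "finite B"
    using B(1) by (rule independent_imp_finite)
  have "\<exists>w. norm w \<le> (\<Sum>b\<in>B. norm b) \<and> torus_proj \<Lambda> w = torus_proj \<Lambda> v" for v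
  proof -
    obtain r where r: "v = (\<Sum>b\<in>B. r b *\<^sub>R b)"
      using B(2) span_finite[OF fin] by blast
    define w where "w = (\<Sum>b\<in>B. frac (r b) *\<^sub>R b)"
    have "v - w = (\<Sum>b\<in>B. real_of_int \<lfloor>r b\<rfloor> *\<^sub>R b)"
      by (simp add: r w_def frac_def sum_subtractf[symmetric] scaleR_left_diff_distrib)
    then have "v - w \<in> \<Lambda>" unfolding L by (intro range_eqI)
    then have "torus_proj \<Lambda> w = torus_proj \<Lambda> v"
      by (simp add: torus_proj_eq_iff[OF assms, of v w, symmetric])
    moreover have "norm w \<le> (\<Sum>b\<in>B. norm b)"
      unfolding w_def
      by (intro sum_norm_le) (auto simp: frac_lt_1 mult_left_le_one_le less_imp_le)
    ultimately show ?thesis by blast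
  qed
  then show ?thesis using that by blast
qed

section \<open>Exponential growth rates\<close>

lemma limsup_exponential_upper:
  fixes N :: "nat \<Rightarrow> nat" and C g :: real
  assumes "1 \<le> C" "1 \<le> g" "\<And>n. real (N n) \<le> C * g ^ n"
  shows "limsup (\<lambda>n. ereal (ln (real (N n)) / real n)) \<le> ereal (ln g)"
proof -
  have "ln (real (N n)) / real n \<le> ln C / real n + ln g" if "0 < n" for n
  proof -
    have "ln (real (N n)) \<le> ln (C * g ^ n)"
    \<comment> \<open>\<open>ln 0\<close> has the default value 0, so this case needs a bound that
      is at least 1; this is where \<open>1 \<le> C\<close> enters.\<close>
    proof (cases "N n = 0")
      case True
      have "1 * 1 \<le> C * g ^ n" using assms(1,2) by (intro mult_mono) auto
      with True show ?thesis by simp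
    next
      case False
      then show ?thesis using assms(3)[of n] assms(1,2) by (intro ln_mono) auto
    qed
    also have "\<dots> = ln C + real n * ln g"
      using assms(1,2) by (simp add: ln_mult ln_realpow)
    finally have "ln (real (N n)) / real n \<le> (ln C + real n * ln g) / real n"
      by (rule divide_right_mono) simp
    then show ?thesis using that by (simp add: add_divide_distrib)
  qed
  then have "\<forall>\<^sub>F n in sequentially. ereal (ln (real (N n)) / real n) \<le> ereal (ln C / real n + ln g)"
    by (intro eventually_mono[OF eventually_gt_at_top[of 0]]) simp
  then have "limsup (\<lambda>n. ereal (ln (real (N n)) / real n)) \<le> limsup (\<lambda>n. ereal (ln C / real n + ln g))"
    by (rule Limsup_mono)
  moreover have "(\<lambda>n. ln C / real n + ln g) \<longlonglongrightarrow> 0 + ln g"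
    by (intro tendsto_intros lim_const_over_n)
  then have "limsup (\<lambda>n. ereal (ln C / real n + ln g)) = ereal (ln g)"
    by (intro lim_imp_Limsup) simp_all
  ultimately show ?thesis by simp
qed

lemma limsup_exponential_lower:
  fixes N :: "nat \<Rightarrow> nat" and C g :: real
  assumes "0 < C" "1 \<le> g" "\<And>n. C * g ^ n \<le> real (N (Suc n))"
  shows "ereal (ln g) \<le> limsup (\<lambda>n. ereal (ln (real (N n)) / real n))"
proof -
  \<comment> \<open>The bound on \<open>N (Suc n)\<close> fits a join over the times 0 to n. Writing
    n as \<open>Suc m\<close> loses one factor g, which accounts for the term with
    \<open>- ln g\<close> and vanishes in the limit.\<close>
  have "(ln C - ln g) / real n + ln g \<le> ln (real (N n)) / real n" if n: "0 < n" for n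
  proof -
    obtain m where m: "n = Suc m" using n by (cases n) auto
    have "ln C + real m * ln g = ln (C * g ^ m)"
      using assms(1,2) by (simp add: ln_mult ln_realpow)
    also have "\<dots> \<le> ln (real (N n))"
      using assms(3)[of m] assms(1,2) m by (intro ln_mono) auto
    finally have "(ln C + real m * ln g) / real n \<le> ln (real (N n)) / real n"
      by (rule divide_right_mono) simp
    moreover have "(ln C - ln g) / real n + ln g = (ln C + real m * ln g) / real n"
      by (simp add: m field_simps)
    ultimately show ?thesis by simp
  qed
  then have "\<forall>\<^sub>F n in sequentially. ereal ((ln C - ln g) / real n + ln g) \<le> ereal (ln (real (N n)) / real n)"
    by (intro eventually_mono[OF eventually_gt_at_top[of 0]]) simp
  then have "limsup (\<lambda>n. ereal ((ln C - ln g) / real n + ln g)) \<le> limsup (\<lambda>n. ereal (ln (real (N n)) / real n))"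
    by (rule Limsup_mono)
  moreover have "(\<lambda>n. (ln C - ln g) / real n + ln g) \<longlonglongrightarrow> 0 + ln g"
    by (intro tendsto_intros lim_const_over_n)
  then have "limsup (\<lambda>n. ereal ((ln C - ln g) / real n + ln g)) = ereal (ln g)"
    by (intro lim_imp_Limsup) simp_all
  ultimately show ?thesis by simp
qed

text \<open>The map \<open>c\<close> passes to coordinates with respect to an eigenbasis of A and
  \<open>d\<close> passes back. In them A scales each complex coordinate separately, so orbits can
  be compared coordinate by coordinate.\<close>

locale torus_eigencoordinates =
  fixes \<Lambda> :: "(complex ^ 'n) set" and A :: "complex ^ 'n ^ 'n"
    and c d :: "complex ^ 'n \<Rightarrow> complex ^ 'n" and \<alpha> :: "'n \<Rightarrow> complex"
  assumes lattice: "lattice_in UNIV \<Lambda>"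
    and linear_c: "linear c" and linear_d: "linear d"
    and c_d: "\<And>w. c (d w) = w" and d_c: "\<And>v. d (c v) = v"
    and eigen: "\<And>v i. c (A *v v) $ i = \<alpha> i * c v $ i"
begin

definition M :: "'n \<Rightarrow> real" where "M i = max 1 (cmod (\<alpha> i))"

text \<open>The square counts the two real directions of a complex coordinate; contracting
  coordinates contribute 1.\<close>

definition growth :: real where "growth = (\<Prod>i\<in>UNIV. (M i)\<^sup>2)"

text \<open>The lift of the endomorphism to the universal cover.\<close>

definition step :: "complex ^ 'n \<Rightarrow> complex ^ 'n" where "step v = A *v v"

lemma M_ge_1: "1 \<le> M i"
  by (simp add: M_def)

lemma growth_ge_1: "1 \<le> growth"
  unfolding growth_def using M_ge_1 by (intro prod_ge_1) (simp add: one_le_power)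

lemma cmod_alpha_le: "cmod (\<alpha> i) ^ k \<le> M i ^ k"
  by (intro power_mono) (auto simp: M_def)

lemma growth_power: "(\<Prod>i\<in>UNIV. (M i ^ n)\<^sup>2) = growth ^ n"
  by (simp add: growth_def prod_power_distrib[symmetric] power_mult[symmetric] mult.commute)

lemma step_diff: "(step ^^ k) (v - w) = (step ^^ k) v - (step ^^ k) w"
  by (induction k) (simp_all add: step_def matrix_vector_mult_diff_distrib)

lemma c_step: "c ((step ^^ k) v) $ i = \<alpha> i ^ k * c v $ i"
  by (induction k) (simp_all add: step_def eigen)

section \<open>Boxes in eigencoordinates and the topology of the torus\<close>

lemma c_diff: "c (v - w) = c v - c w"
  by (rule linear_diff[OF linear_c])

lemma c_small:
  assumes "0 < e"
  obtains \<delta> where "0 < \<delta>" "\<And>v. (\<And>i. cmod (c v $ i) < \<delta>) \<Longrightarrow> norm v < e"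
proof -
  obtain K where K: "0 < K" "\<And>w. norm (d w) \<le> norm w * K"
    using bounded_linear.pos_bounded[OF linear_conv_bounded_linear[THEN iffD1, OF linear_d]] by blast
  define N where "N = real CARD('n)"
  have N: "0 < N" by (simp add: N_def)
  show ?thesis
  proof (rule that[of "e / (K * N)"])
    show "0 < e / (K * N)" using assms K(1) N by simp
  next
    fix v assume v: "\<And>i. cmod (c v $ i) < e / (K * N)"
    have "norm (c v) \<le> (\<Sum>i\<in>UNIV. cmod (c v $ i))"
      by (simp add: norm_vec_def L2_set_le_sum)
    also have "\<dots> < (\<Sum>i\<in>(UNIV :: 'n set). e / (K * N))"
      using v by (intro sum_strict_mono) auto
    also have "\<dots> = e / K" using N by (simp add: N_def)
    finally have "norm (c v) * K < e" using K(1) by (simp add: field_simps)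
    with K(2)[of "c v"] show "norm v < e" by (simp add: d_c)
  qed
qed

lemma c_bounded:
  obtains K where "0 < K" "\<And>v i. cmod (c v $ i) \<le> norm v * K"
proof -
  obtain K where K: "0 < K" "\<And>w. norm (c w) \<le> norm w * K"
    using bounded_linear.pos_bounded[OF linear_conv_bounded_linear[THEN iffD1, OF linear_c]] by blast
  have "cmod (c v $ i) \<le> norm v * K" for v i
    using Finite_Cartesian_Product.norm_nth_le[of "c v" i] K(2)[of v] by linarith
  with K(1) that show ?thesis by blast
qed

lemma lattice_c_discrete:
  obtains e where "0 < e" "\<And>l. l \<in> \<Lambda> \<Longrightarrow> (\<And>i. cmod (c l $ i) < e) \<Longrightarrow> l = 0"
proof -
  obtain e where e: "0 < e" "\<And>x. x \<in> \<Lambda> \<Longrightarrow> x \<noteq> 0 \<Longrightarrow> e \<le> norm x"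
    using lattice_in_discrete[OF lattice] by blast
  obtain \<delta> where \<delta>: "0 < \<delta>" "\<And>v. (\<And>i. cmod (c v $ i) < \<delta>) \<Longrightarrow> norm v < e"
    using c_small[OF e(1)] by blast
  show ?thesis
  proof (rule that[OF \<delta>(1)])
    fix l assume l: "l \<in> \<Lambda>" "\<And>i. cmod (c l $ i) < \<delta>"
    from \<delta>(2)[of l] l(2) have "norm l < e" by blast
    with e(2)[OF l(1)] show "l = 0" by force
  qed
qed

lemma open_box: "open {v. \<forall>i. cmod (c (v - y) $ i) < r}"
proof -
  have "continuous_on UNIV c"
    using linear_conv_bounded_linear linear_c linear_continuous_on by blast
  then have "continuous_on UNIV (\<lambda>v. c (v - y))"
    by (rule continuous_on_compose2) (auto intro!: continuous_intros)
  then have "open {v. cmod (c (v - y) $ i) < r}" for i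
    by (intro open_Collect_less continuous_intros)
  then have "open (\<Inter>i. {v. cmod (c (v - y) $ i) < r})"
    by (intro open_INT) auto
  moreover have "(\<Inter>i. {v. cmod (c (v - y) $ i) < r}) = {v. \<forall>i. cmod (c (v - y) $ i) < r}"
    by auto
  ultimately show ?thesis by simp
qed

text \<open>Heine-Borel gives a Lebesgue number on a compact ball that meets every class, and
  lattice translations carry it to all centres.\<close>

lemma open_cover_lebesgue_number:
  assumes "open_cover (torus_topology \<Lambda>) \<U>"
  obtains \<delta> where "0 < \<delta>"
    "\<And>y. \<exists>U\<in>\<U>. \<forall>v. (\<forall>i. cmod (c (v - y) $ i) < \<delta>) \<longrightarrow> torus_proj \<Lambda> v \<in> U"
proof -
  obtain R where R: "\<And>v. \<exists>w. norm w \<le> R \<and> torus_proj \<Lambda> w = torus_proj \<Lambda> v"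
    using lattice_bounded_representative[OF lattice] by blast
  have U: "\<And>U. U \<in> \<U> \<Longrightarrow> open (torus_proj \<Lambda> -` U)" "\<Union>\<U> = range (torus_proj \<Lambda>)"
    using assms by (auto simp: open_cover_def openin_torus_topology topspace_torus_topology carrier_torus)
  obtain e where e: "0 < e" "\<And>x. x \<in> cball 0 R \<Longrightarrow> \<exists>S\<in>(-`) (torus_proj \<Lambda>) ` \<U>. ball x e \<subseteq> S"
  proof (rule Heine_Borel_lemma[of "cball 0 R" "(-`) (torus_proj \<Lambda>) ` \<U>"])
    show "cball 0 R \<subseteq> \<Union> ((-`) (torus_proj \<Lambda>) ` \<U>)"
    proof
      fix x
      have "torus_proj \<Lambda> x \<in> \<Union>\<U>" using U(2) by simp
      then show "x \<in> \<Union> ((-`) (torus_proj \<Lambda>) ` \<U>)" by auto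
    qed
  qed (use U(1) in auto)
  obtain \<delta> where \<delta>: "0 < \<delta>" "\<And>v. (\<And>i. cmod (c v $ i) < \<delta>) \<Longrightarrow> norm v < e"
    using c_small[OF e(1)] by blast
  show ?thesis
  proof (rule that[OF \<delta>(1)])
    fix y
    obtain w where w: "norm w \<le> R" "torus_proj \<Lambda> w = torus_proj \<Lambda> y" using R by blast
    then obtain U where U: "U \<in> \<U>" "ball w e \<subseteq> torus_proj \<Lambda> -` U" using e(2)[of w] by auto
    have "torus_proj \<Lambda> v \<in> U" if v: "\<forall>i. cmod (c (v - y) $ i) < \<delta>" for v
    proof -
      have "norm (v - y) < e" using \<delta>(2) v by blast
      \<comment> \<open>This point differs from v by the lattice vector \<open>w - y\<close>, so
        both have the same image in the torus.\<close>
      then have "w + (v - y) \<in> ball w e" by (simp add: dist_norm norm_minus_commute)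
      then have "torus_proj \<Lambda> (w + (v - y)) \<in> U" using U(2) by blast
      moreover have "(w + (v - y)) - v \<in> \<Lambda>"
        using w(2) unfolding torus_proj_eq_iff[OF lattice] by simp
      then have "torus_proj \<Lambda> (w + (v - y)) = torus_proj \<Lambda> v"
        by (rule torus_proj_eq_iff[OF lattice, THEN iffD2])
      ultimately show ?thesis by simp
    qed
    with U(1) show "\<exists>U\<in>\<U>. \<forall>v. (\<forall>i. cmod (c (v - y) $ i) < \<delta>) \<longrightarrow> torus_proj \<Lambda> v \<in> U" by blast
  qed
qed

lemma iterate_torus_proj:
  assumes "\<And>v. f (torus_proj \<Lambda> v) = torus_proj \<Lambda> (A *v v)"
  shows "(f ^^ k) (torus_proj \<Lambda> v) = torus_proj \<Lambda> ((step ^^ k) v)"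
  by (induction k) (simp_all add: assms step_def)

text \<open>Bounded representatives fill a box in eigencoordinates. Cut into cells of side
  \<open>s i\<close>, it needs a constant times \<open>(M i ^ n)\<^sup>2\<close> cells in coordinate
  i. The orbit of a point follows that of its grid point up to \<delta> for n steps, so one set of
  the join serves a whole cell.\<close>

lemma finite_cover_iterated_join:
  assumes f: "\<And>v. f (torus_proj \<Lambda> v) = torus_proj \<Lambda> (A *v v)"
    and cover: "open_cover (torus_topology \<Lambda>) \<U>"
  obtains C where "1 \<le> C"
    "\<And>n. \<exists>\<V> \<subseteq> iterated_join (torus_topology \<Lambda>) f \<U> n. finite \<V> \<and>
       \<Union>\<V> = topspace (torus_topology \<Lambda>) \<and> real (card \<V>) \<le> C * growth ^ n"
proof -
  obtain \<delta> where \<delta>: "0 < \<delta>"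
    "\<And>y. \<exists>U\<in>\<U>. \<forall>v. (\<forall>i. cmod (c (v - y) $ i) < \<delta>) \<longrightarrow> torus_proj \<Lambda> v \<in> U"
    using open_cover_lebesgue_number[OF cover] by blast
  obtain U where U: "\<And>y. U y \<in> \<U>"
    "\<And>y v. (\<And>i. cmod (c (v - y) $ i) < \<delta>) \<Longrightarrow> torus_proj \<Lambda> v \<in> U y"
    using \<delta>(2) by metis
  obtain R0 where R0: "\<And>v. \<exists>w. norm w \<le> R0 \<and> torus_proj \<Lambda> w = torus_proj \<Lambda> v"
    using lattice_bounded_representative[OF lattice] by blast
  obtain K where K: "0 < K" "\<And>v i. cmod (c v $ i) \<le> norm v * K"
    using c_bounded by blast
  define R where "R = \<bar>R0\<bar> * K"
  have R: "0 \<le> R" using K(1) by (simp add: R_def)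
  \<comment> \<open>Chosen so that \<open>2 * N i + 1\<close>, which is at most
    \<open>2 * (R / s i) + 5\<close>, is bounded by \<open>a * M i ^ n\<close>; here
    \<open>R / s i\<close> equals \<open>2 * R / \<delta> * M i ^ n\<close>.\<close>
  define a where "a = 4 * R / \<delta> + 5"
  have a: "1 \<le> a" using R \<delta>(1) by (simp add: a_def)
  define C where "C = (\<Prod>i\<in>(UNIV::'n set). a\<^sup>2)"
  have "1 \<le> C" unfolding C_def using a by (intro prod_ge_1) (simp add: one_le_power)
  moreover have "\<exists>\<V> \<subseteq> iterated_join (torus_topology \<Lambda>) f \<U> n. finite \<V> \<and>
       \<Union>\<V> = topspace (torus_topology \<Lambda>) \<and> real (card \<V>) \<le> C * growth ^ n" for n
  proof -
    \<comment> \<open>Cells of this width stay \<open>\<delta>\<close>-small under \<open>n\<close> steps.\<close>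
    define s where "s i = \<delta> / (2 * M i ^ n)" for i
    have Mn: "1 \<le> M i ^ n" for i using M_ge_1 by (simp add: one_le_power)
    have s: "0 < s i" for i using \<delta>(1) Mn[of i] by (simp add: s_def)
    \<comment> \<open>The extra 1 leaves room for rounding down a coordinate near
      \<open>- R / s i\<close>.\<close>
    define N where "N i = \<lceil>R / s i\<rceil> + 1" for i
    define I where "I = PiE (UNIV :: 'n set) (\<lambda>i. {- N i..N i} \<times> {- N i..N i})"
    have finI: "finite I" unfolding I_def by (intro finite_PiE) auto
    have N0: "0 \<le> N i" for i
      using divide_nonneg_pos[OF R s[of i]] unfolding N_def by linarith
    have cardI: "real (card I) \<le> C * growth ^ n"
    proof -
      have "card I = (\<Prod>i\<in>UNIV. (nat (2 * N i + 1))\<^sup>2)"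
        unfolding I_def by (simp add: card_PiE card_cartesian_product power2_eq_square)
      then have "real (card I) = (\<Prod>i\<in>UNIV. (real (nat (2 * N i + 1)))\<^sup>2)" by simp
      also have "\<dots> \<le> (\<Prod>i\<in>UNIV. (a * M i ^ n)\<^sup>2)"
      proof (intro prod_mono conjI power_mono)
        fix i
        have "real_of_int (N i) \<le> R / s i + 2" unfolding N_def by linarith
        then have "real (nat (2 * N i + 1)) \<le> 2 * (R / s i) + 5"
          using N0[of i] by simp
        also have "R / s i = 2 * R / \<delta> * M i ^ n" using \<delta>(1) by (simp add: s_def)
        also have "2 * (2 * R / \<delta> * M i ^ n) + 5 \<le> a * M i ^ n"
          using Mn[of i] by (simp add: a_def ring_distribs)
        finally show "real (nat (2 * N i + 1)) \<le> a * M i ^ n" .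
      qed auto
      also have "\<dots> = C * growth ^ n"
        by (simp add: C_def growth_power[symmetric] power_mult_distrib prod.distrib)
      finally show ?thesis .
    qed
    define g where "g j = d (\<chi> i. complex_of_real (s i) *
        Complex (real_of_int (fst (j i))) (real_of_int (snd (j i))))" for j :: "'n \<Rightarrow> int \<times> int"
    have near: "\<exists>j\<in>I. \<forall>i. cmod (c (w - g j) $ i) < 2 * s i" if w: "norm w \<le> R0" for w
    proof -
      define q where "q i = c w $ i / complex_of_real (s i)" for i
      define j where "j i = (\<lfloor>Re (q i)\<rfloor>, \<lfloor>Im (q i)\<rfloor>)" for i
      have q: "cmod (q i) \<le> R / s i" for i
      proof -
        have "norm w * K \<le> \<bar>R0\<bar> * K" using w K(1) by (intro mult_right_mono) auto
        then have "cmod (c w $ i) \<le> R" using K(2)[of w i] by (simp add: R_def)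
        then show ?thesis using s[of i] by (simp add: q_def norm_divide divide_right_mono)
      qed
      have "j \<in> I"
      proof -
        have "\<bar>Re (q i)\<bar> \<le> R / s i" "\<bar>Im (q i)\<bar> \<le> R / s i" for i
          using q[of i] abs_Re_le_cmod[of "q i"] abs_Im_le_cmod[of "q i"] by linarith+
        then have "- N i \<le> \<lfloor>Re (q i)\<rfloor> \<and> \<lfloor>Re (q i)\<rfloor> \<le> N i \<and> - N i \<le> \<lfloor>Im (q i)\<rfloor> \<and> \<lfloor>Im (q i)\<rfloor> \<le> N i" for i
          unfolding N_def by (smt (verit) le_floor_iff floor_le_iff le_of_int_ceiling of_int_add of_int_minus of_int_1)
        then show ?thesis by (auto simp: I_def j_def)
      qed
      moreover have "cmod (c (w - g j) $ i) < 2 * s i" for i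
      proof -
        define z where "z = Complex (frac (Re (q i))) (frac (Im (q i)))"
        have "c (w - g j) $ i = complex_of_real (s i) * z"
          using s[of i] by (simp add: c_diff g_def c_d j_def z_def frac_def q_def complex_eq_iff field_simps)
        moreover have "cmod z < 2"
          using cmod_le[of z] frac_lt_1[of "Re (q i)"] frac_lt_1[of "Im (q i)"] by (simp add: z_def)
        ultimately show ?thesis using s[of i] by (simp add: norm_mult)
      qed
      ultimately show ?thesis by blast
    qed
    \<comment> \<open>The member of the join whose itinerary through the cover is that of the grid
      point \<open>g j\<close>.\<close>
    define S where "S j = {x \<in> topspace (torus_topology \<Lambda>). \<forall>k<n. (f ^^ k) x \<in> U ((step ^^ k) (g j))}" for j
    have "S ` I \<subseteq> iterated_join (torus_topology \<Lambda>) f \<U> n"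
    proof (rule image_subsetI)
      show "S j \<in> iterated_join (torus_topology \<Lambda>) f \<U> n" for j
        unfolding iterated_join_def S_def
        by (intro CollectI exI[of _ "\<lambda>k. U ((step ^^ k) (g j))"]) (simp add: U(1))
    qed
    moreover have "topspace (torus_topology \<Lambda>) \<subseteq> \<Union>(S ` I)"
    proof
      fix x assume x: "x \<in> topspace (torus_topology \<Lambda>)"
      then obtain v where "x = torus_proj \<Lambda> v"
        unfolding topspace_torus_topology carrier_torus by blast
      then obtain w where w: "norm w \<le> R0" "x = torus_proj \<Lambda> w"
        using R0[of v] by auto
      obtain j where j: "j \<in> I" "\<And>i. cmod (c (w - g j) $ i) < 2 * s i" using near[OF w(1)] by blast
      have "(f ^^ k) x \<in> U ((step ^^ k) (g j))" if "k < n" for k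
        unfolding w(2) iterate_torus_proj[OF f]
      proof (rule U(2))
        fix i
        have "cmod (c ((step ^^ k) w - (step ^^ k) (g j)) $ i) = cmod (\<alpha> i) ^ k * cmod (c (w - g j) $ i)"
          by (simp add: step_diff[symmetric] c_step norm_mult norm_power)
        also have "\<dots> \<le> M i ^ n * cmod (c (w - g j) $ i)"
          using cmod_alpha_le[of i k] power_increasing[OF less_imp_le[OF that] M_ge_1[of i]]
          by (intro mult_right_mono) auto
        also have "\<dots> < M i ^ n * (2 * s i)"
          using j(2)[of i] Mn[of i] by (intro mult_strict_left_mono) auto
        also have "\<dots> = \<delta>" using M_ge_1[of i] by (simp add: s_def)
        finally show "cmod (c ((step ^^ k) w - (step ^^ k) (g j)) $ i) < \<delta>" .
      qed
      then have "x \<in> S j" using x by (simp add: S_def)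
      with j(1) show "x \<in> \<Union>(S ` I)" by blast
    qed
    then have "\<Union>(S ` I) = topspace (torus_topology \<Lambda>)" by (auto simp: S_def)
    moreover have "real (card (S ` I)) \<le> C * growth ^ n"
      using card_image_le[OF finI, of S] cardI by linarith
    ultimately show ?thesis using finI by blast
  qed
  ultimately show ?thesis using that by blast
qed

text \<open>Nearby lifts in one member of the join stay close for n steps, so grid points with
  spacing of order \<open>1 / M i ^ n\<close> need different members. The factor 1/16 is the square
  of 1/4: about \<open>M i ^ n / 4\<close> grid positions are used in each real direction.\<close>

lemma separating_cover:
  assumes f: "\<And>v. f (torus_proj \<Lambda> v) = torus_proj \<Lambda> (A *v v)"
  obtains \<U> where "open_cover (torus_topology \<Lambda>) \<U>"
    "\<And>n \<V>. \<V> \<subseteq> iterated_join (torus_topology \<Lambda>) f \<U> (Suc n) \<Longrightarrow> finite \<V> \<Longrightarrow>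
       \<Union>\<V> = topspace (torus_topology \<Lambda>) \<Longrightarrow> (\<Prod>i\<in>(UNIV::'n set). 1 / 16) * growth ^ n \<le> real (card \<V>)"
proof -
  obtain e where e: "0 < e" "\<And>l. l \<in> \<Lambda> \<Longrightarrow> (\<And>i. cmod (c l $ i) < e) \<Longrightarrow> l = 0"
    using lattice_c_discrete by blast
  define m where "m = (\<Sum>i\<in>UNIV. M i)"
  have Mm: "M i \<le> m" for i
    unfolding m_def by (rule member_le_sum) (use M_ge_1 order_trans[OF zero_le_one] in auto)
  have m: "1 \<le> m" using M_ge_1 Mm order_trans by blast
  define \<epsilon> where "\<epsilon> = e / (2 * (m + 1))"
  have \<epsilon>: "0 < \<epsilon>" "2 * \<epsilon> * (m + 1) = e" using e(1) m by (auto simp: \<epsilon>_def field_simps)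
  \<comment> \<open>\<open>\<epsilon>\<close> is so small that a lift of an orbit difference cannot jump to another lattice translate
    between consecutive steps.\<close>
  define Q where "Q y = torus_proj \<Lambda> ` {v. \<forall>i. cmod (c (v - y) $ i) < \<epsilon>}" for y
  have cover: "open_cover (torus_topology \<Lambda>) (range Q)"
    unfolding open_cover_def
  proof (intro conjI ballI)
    show "openin (torus_topology \<Lambda>) S" if "S \<in> range Q" for S
      using that openin_torus_proj_image[OF lattice open_box] by (auto simp: Q_def)
    have "torus_proj \<Lambda> y \<in> Q y" for y
      using \<epsilon>(1) by (auto simp: Q_def linear_0[OF linear_c])
    then show "\<Union>(range Q) = topspace (torus_topology \<Lambda>)"
      by (auto simp: topspace_torus_topology carrier_torus) (auto simp: Q_def)
  qed
  show ?thesis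
  proof (rule that[OF cover])
    fix n \<V>
    assume V: "\<V> \<subseteq> iterated_join (torus_topology \<Lambda>) f (range Q) (Suc n)" "finite \<V>"
      "\<Union>\<V> = topspace (torus_topology \<Lambda>)"
    \<comment> \<open>The cover controls the difference of two orbits only modulo \<Lambda>.
      Induction over time shows that the difference of the lifts is the small representative itself,
      so an expanding coordinate must have been tiny at the start.\<close>
    have close: "M i ^ n * cmod (c (v - w) $ i) < 2 * \<epsilon>"
      if S: "S \<in> \<V>" "torus_proj \<Lambda> v \<in> S" "torus_proj \<Lambda> w \<in> S"
        and vw: "\<And>i. cmod (c (v - w) $ i) \<le> 2 * \<epsilon>" for S v w i
    proof -
      obtain u where u: "S = {x \<in> topspace (torus_topology \<Lambda>). \<forall>k<Suc n. (f ^^ k) x \<in> u k}"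
        "\<forall>k<Suc n. u k \<in> range Q"
        using S(1) V(1) unfolding iterated_join_def by blast
      have near: "\<exists>q. (step ^^ k) (v - w) - q \<in> \<Lambda> \<and> (\<forall>i. cmod (c q $ i) < 2 * \<epsilon>)" if k: "k \<le> n" for k
      proof -
        obtain y where y: "u k = Q y" using u(2) k less_Suc_eq_le by blast
        have "torus_proj \<Lambda> ((step ^^ k) v) \<in> Q y" "torus_proj \<Lambda> ((step ^^ k) w) \<in> Q y"
          using S(2,3) u(1) k y by (auto simp: iterate_torus_proj[OF f] less_Suc_eq_le)
        then obtain p p' where p: "(step ^^ k) v - p \<in> \<Lambda>" "\<And>i. cmod (c (p - y) $ i) < \<epsilon>"
            "(step ^^ k) w - p' \<in> \<Lambda>" "\<And>i. cmod (c (p' - y) $ i) < \<epsilon>"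
          unfolding Q_def by (auto simp: torus_proj_eq_iff[OF lattice])
        have "((step ^^ k) v - p) - ((step ^^ k) w - p') \<in> \<Lambda>"
          using lattice_in_subgroup(4)[OF lattice p(1,3)] .
        then have "(step ^^ k) (v - w) - (p - p') \<in> \<Lambda>"
          by (simp add: step_diff algebra_simps)
        moreover have "cmod (c (p - p') $ i) < 2 * \<epsilon>" for i
        proof -
          have "c (p - p') $ i = c (p - y) $ i - c (p' - y) $ i" by (simp add: c_diff)
          then show ?thesis
            using norm_triangle_ineq4[of "c (p - y) $ i" "c (p' - y) $ i"] p(2)[of i] p(4)[of i] by simp
        qed
        ultimately show ?thesis by blast
      qed
      \<comment> \<open>The iterate minus its small representative q is a lattice vector with
        coordinates below \<open>2 * \<epsilon> * m + 2 * \<epsilon>\<close>, which is e; hence it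
        is 0 and the bound improves to that of q.\<close>
      have small: "cmod (c ((step ^^ k) (v - w)) $ i) < 2 * \<epsilon>"
        if k: "k \<le> n" and le: "\<And>i. cmod (c ((step ^^ k) (v - w)) $ i) \<le> 2 * \<epsilon> * m" for k i
      proof -
        obtain q where q: "(step ^^ k) (v - w) - q \<in> \<Lambda>" "\<And>i. cmod (c q $ i) < 2 * \<epsilon>"
          using near[OF k] by blast
        have "cmod (c ((step ^^ k) (v - w) - q) $ i) < e" for i
        proof -
          have "cmod (c ((step ^^ k) (v - w) - q) $ i) < 2 * \<epsilon> * m + 2 * \<epsilon>"
            using norm_triangle_ineq4[of "c ((step ^^ k) (v - w)) $ i" "c q $ i"] le[of i] q(2)[of i]
            by (simp add: c_diff)
          also have "\<dots> = e" using \<epsilon>(2) by (simp add: algebra_simps)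
          finally show ?thesis .
        qed
        then have "(step ^^ k) (v - w) - q = 0" using e(2) q(1) by blast
        then show ?thesis using q(2)[of i] by simp
      qed
      have all: "cmod (c ((step ^^ k) (v - w)) $ i) < 2 * \<epsilon>" if "k \<le> n" for k i
        using that
      proof (induction k arbitrary: i)
        case 0
        have "2 * \<epsilon> * 1 \<le> 2 * \<epsilon> * m" using \<epsilon>(1) m by (intro mult_left_mono) auto
        then have "cmod (c ((step ^^ 0) (v - w)) $ i) \<le> 2 * \<epsilon> * m" for i
          using vw[of i] by simp
        then show ?case by (intro small) auto
      next
        case (Suc k)
        show ?case
        proof (rule small[OF Suc.prems])
          fix i
          have "cmod (c ((step ^^ Suc k) (v - w)) $ i) = cmod (\<alpha> i) * cmod (c ((step ^^ k) (v - w)) $ i)"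
            by (simp add: step_def eigen norm_mult)
          also have "\<dots> \<le> m * (2 * \<epsilon>)"
            using Suc.IH[of i] Suc.prems Mm[of i] m by (intro mult_mono) (auto simp: M_def)
          finally show "cmod (c ((step ^^ Suc k) (v - w)) $ i) \<le> 2 * \<epsilon> * m" by (simp add: mult_ac)
        qed
      qed
      \<comment> \<open>A non-expanding coordinate has \<open>M i = 1\<close> and is bounded at time
        0; an expanding one is bounded at time n.\<close>
      show ?thesis
      proof (cases "cmod (\<alpha> i) \<le> 1")
        case True
        then show ?thesis using all[of 0 i] by (simp add: M_def)
      next
        case False
        then show ?thesis using all[of n i] by (simp add: M_def c_step norm_mult norm_power)
      qed
    qed
    \<comment> \<open>Grid points of this spacing are pairwise separated within \<open>n\<close> steps.\<close>
    define s where "s i = 2 * \<epsilon> / M i ^ n" for i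
    have Mn: "1 \<le> M i ^ n" for i using M_ge_1 by (simp add: one_le_power)
    have s: "0 < s i" for i using \<epsilon>(1) Mn[of i] by (simp add: s_def)
    \<comment> \<open>Indices below \<open>L i\<close> are at most \<open>M i ^ n / 4\<close>. After
      scaling by \<open>s i\<close>, two grid points then differ by at most \<epsilon> in each
      coordinate, within the range where \<open>close\<close> applies.\<close>
    define L where "L i = nat \<lfloor>M i ^ n / 4\<rfloor> + 1" for i
    have L: "M i ^ n / 4 \<le> real (L i)" for i unfolding L_def by linarith
    define I where "I = PiE (UNIV :: 'n set) (\<lambda>i. {..<L i} \<times> {..<L i})"
    define g where "g j = d (\<chi> i. complex_of_real (s i) *
        Complex (real (fst (j i))) (real (snd (j i))))" for j :: "'n \<Rightarrow> nat \<times> nat"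
    have g_diff: "cmod (c (g j - g j') $ i) = s i *
        cmod (Complex (real (fst (j i)) - real (fst (j' i))) (real (snd (j i)) - real (snd (j' i))))" for j j' i
    proof -
      have "c (g j - g j') $ i = complex_of_real (s i) *
          Complex (real (fst (j i)) - real (fst (j' i))) (real (snd (j i)) - real (snd (j' i)))"
        by (simp add: c_diff g_def c_d complex_eq_iff right_diff_distrib)
      then show ?thesis using s[of i] by (simp add: norm_mult)
    qed
    have "\<exists>S\<in>\<V>. torus_proj \<Lambda> (g j) \<in> S" for j
      using V(3) by (auto simp: topspace_torus_topology carrier_torus)
    then obtain T where T: "\<And>j. T j \<in> \<V>" "\<And>j. torus_proj \<Lambda> (g j) \<in> T j" by metis
    have "inj_on T I"
    proof (rule inj_onI, rule ccontr)
      fix j j' assume j: "j \<in> I" "j' \<in> I" "T j = T j'" "j \<noteq> j'"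
      then obtain i where i: "j i \<noteq> j' i" by blast
      have "cmod (c (g j - g j') $ i) \<le> 2 * \<epsilon>" for i
      proof -
        have *: "\<bar>real x - real y\<bar> \<le> M i ^ n / 4" if "x < L i" "y < L i" for x y
        proof -
          have "real x \<le> M i ^ n / 4" "real y \<le> M i ^ n / 4"
            using that Mn[of i] unfolding L_def by linarith+
          then show ?thesis by linarith
        qed
        have "j i \<in> {..<L i} \<times> {..<L i}" "j' i \<in> {..<L i} \<times> {..<L i}"
          using j(1,2) by (auto simp: I_def)
        then have "\<bar>real (fst (j i)) - real (fst (j' i))\<bar> \<le> M i ^ n / 4"
          "\<bar>real (snd (j i)) - real (snd (j' i))\<bar> \<le> M i ^ n / 4"
          unfolding mem_Times_iff lessThan_iff by (blast intro: *)+
        then have "cmod (Complex (real (fst (j i)) - real (fst (j' i))) (real (snd (j i)) - real (snd (j' i)))) \<le> M i ^ n / 2"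
          by (intro order_trans[OF cmod_le]) simp
        then have "cmod (c (g j - g j') $ i) \<le> s i * (M i ^ n / 2)"
          unfolding g_diff using s[of i] by (intro mult_left_mono) auto
        also have "\<dots> = \<epsilon>" using M_ge_1[of i] by (simp add: s_def)
        finally show ?thesis using \<epsilon>(1) by simp
      qed
      then have "M i ^ n * cmod (c (g j - g j') $ i) < 2 * \<epsilon>"
        by (intro close[OF T(1)[of j] T(2)]) (use T(2)[of j'] j(3) in auto)
      \<comment> \<open>As \<open>M i ^ n * s i\<close> is \<open>2 * \<epsilon>\<close>, the
        nonzero integer vector of index differences would have length below 1.\<close>
      then have "2 * \<epsilon> * cmod (Complex (real (fst (j i)) - real (fst (j' i))) (real (snd (j i)) - real (snd (j' i)))) < 2 * \<epsilon> * 1"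
        unfolding g_diff using M_ge_1[of i] by (simp add: s_def)
      then have "cmod (Complex (real (fst (j i)) - real (fst (j' i))) (real (snd (j i)) - real (snd (j' i)))) < 1"
        using \<epsilon>(1) by simp
      moreover have "1 \<le> \<bar>real x - real y\<bar>" if "x \<noteq> y" for x y :: nat
        using that by linarith
      ultimately show False
        using i abs_Re_le_cmod[of "Complex (real (fst (j i)) - real (fst (j' i))) (real (snd (j i)) - real (snd (j' i)))"]
          abs_Im_le_cmod[of "Complex (real (fst (j i)) - real (fst (j' i))) (real (snd (j i)) - real (snd (j' i)))"]
        by (force simp: prod_eq_iff)
    qed
    then have "card I \<le> card \<V>" using T(1) V(2) by (intro card_inj_on_le) auto
    moreover have "(\<Prod>i\<in>(UNIV::'n set). 1 / 16) * growth ^ n \<le> real (card I)"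
    proof -
      have "(\<Prod>i\<in>(UNIV::'n set). 1 / 16) * growth ^ n = (\<Prod>i\<in>UNIV. (M i ^ n / 4)\<^sup>2)"
        unfolding growth_power[symmetric] prod.distrib[symmetric]
        by (intro prod.cong) (simp_all add: power_divide)
      also have "\<dots> \<le> (\<Prod>i\<in>UNIV. (real (L i))\<^sup>2)"
      proof (intro prod_mono conjI power_mono L)
        show "0 \<le> M i ^ n / 4" for i using Mn[of i] by simp
      qed simp
      also have "\<dots> = real (card I)"
        unfolding I_def by (simp add: card_PiE card_cartesian_product power2_eq_square)
      finally show ?thesis .
    qed
    ultimately show "(\<Prod>i\<in>(UNIV::'n set). 1 / 16) * growth ^ n \<le> real (card \<V>)" by linarith
  qed
qed

theorem topological_entropy_eq:
  assumes f: "\<And>v. f (torus_proj \<Lambda> v) = torus_proj \<Lambda> (A *v v)"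
  shows "topological_entropy (torus_topology \<Lambda>) f = ereal (ln growth)"
proof (rule antisym)
  show "topological_entropy (torus_topology \<Lambda>) f \<le> ereal (ln growth)"
    unfolding topological_entropy_def
  proof (rule SUP_least)
    fix \<U> assume "\<U> \<in> {\<U>. open_cover (torus_topology \<Lambda>) \<U>}"
    then obtain C where C: "1 \<le> C"
      "\<And>n. \<exists>\<V> \<subseteq> iterated_join (torus_topology \<Lambda>) f \<U> n. finite \<V> \<and>
         \<Union>\<V> = topspace (torus_topology \<Lambda>) \<and> real (card \<V>) \<le> C * growth ^ n"
      using finite_cover_iterated_join[OF f] by blast
    have "real (subcover_number (torus_topology \<Lambda>) (iterated_join (torus_topology \<Lambda>) f \<U> n)) \<le> C * growth ^ n" for n
    proof -
      obtain \<V> where V: "\<V> \<subseteq> iterated_join (torus_topology \<Lambda>) f \<U> n" "finite \<V>"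
        "\<Union>\<V> = topspace (torus_topology \<Lambda>)" "real (card \<V>) \<le> C * growth ^ n"
        using C(2)[of n] by blast
      have "subcover_number (torus_topology \<Lambda>) (iterated_join (torus_topology \<Lambda>) f \<U> n) \<le> card \<V>"
        unfolding subcover_number_def using V(1-3) by (intro cInf_lower) auto
      with V(4) show ?thesis by linarith
    qed
    then show "limsup (\<lambda>n. ereal (ln (real (subcover_number (torus_topology \<Lambda>)
        (iterated_join (torus_topology \<Lambda>) f \<U> n))) / real n)) \<le> ereal (ln growth)"
      by (rule limsup_exponential_upper[OF C(1) growth_ge_1])
  qed
next
  obtain \<U> where U: "open_cover (torus_topology \<Lambda>) \<U>"
    "\<And>n \<V>. \<V> \<subseteq> iterated_join (torus_topology \<Lambda>) f \<U> (Suc n) \<Longrightarrow> finite \<V> \<Longrightarrow>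
       \<Union>\<V> = topspace (torus_topology \<Lambda>) \<Longrightarrow> (\<Prod>i\<in>(UNIV::'n set). 1 / 16) * growth ^ n \<le> real (card \<V>)"
    using separating_cover[OF f] by blast
  have "(\<Prod>i\<in>(UNIV::'n set). 1 / 16) * growth ^ n \<le>
      real (subcover_number (torus_topology \<Lambda>) (iterated_join (torus_topology \<Lambda>) f \<U> (Suc n)))" for n
  proof -
    let ?X = "{card \<V> |\<V>. \<V> \<subseteq> iterated_join (torus_topology \<Lambda>) f \<U> (Suc n) \<and> finite \<V> \<and>
        \<Union>\<V> = topspace (torus_topology \<Lambda>)}"
    \<comment> \<open>The upper estimate supplies a finite subcover. Without one the infimum would
      run over the empty set and would not be the size of a subcover.\<close>
    obtain C where C: "1 \<le> C" "\<And>n. \<exists>\<V> \<subseteq> iterated_join (torus_topology \<Lambda>) f \<U> n. finite \<V> \<and>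
         \<Union>\<V> = topspace (torus_topology \<Lambda>) \<and> real (card \<V>) \<le> C * growth ^ n"
      by (rule finite_cover_iterated_join[OF f U(1)]) (rule that)
    from C(2)[of "Suc n"] have "?X \<noteq> {}" by blast
    then have "Inf ?X \<in> ?X" by (rule Inf_nat_def1)
    then obtain \<V> where V: "Inf ?X = card \<V>" "\<V> \<subseteq> iterated_join (torus_topology \<Lambda>) f \<U> (Suc n)"
      "finite \<V>" "\<Union>\<V> = topspace (torus_topology \<Lambda>)" by blast
    show ?thesis unfolding subcover_number_def V(1) by (rule U(2)[OF V(2-4)])
  qed
  then have "ereal (ln growth) \<le> limsup (\<lambda>n. ereal (ln (real (subcover_number (torus_topology \<Lambda>)
      (iterated_join (torus_topology \<Lambda>) f \<U> n))) / real n))"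
    by (intro limsup_exponential_lower[OF _ growth_ge_1] prod_pos) auto
  then show "ereal (ln growth) \<le> topological_entropy (torus_topology \<Lambda>) f"
    unfolding topological_entropy_def by (rule SUP_upper2[rotated]) (simp add: U(1))
qed

end

section \<open>Diagonalization\<close>

text \<open>This is \<open>p(A) v\<close>, computed by Horner's scheme directly on the vector,
  without powers of the matrix.\<close>

definition poly_action :: "complex ^ 'n ^ 'n \<Rightarrow> complex poly \<Rightarrow> complex ^ 'n \<Rightarrow> complex ^ 'n" where
  "poly_action A p = fold_coeffs (\<lambda>a g v. a *s v + A *v g v) p (\<lambda>_. 0)"

lemma poly_action_0 [simp]: "poly_action A 0 v = 0"
  by (simp add: poly_action_def)

lemma poly_action_pCons [simp]: "poly_action A (pCons a p) v = a *s v + A *v poly_action A p v"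
  by (cases "a = 0 \<and> p = 0") (auto simp: poly_action_def)

lemma poly_action_1 [simp]: "poly_action A 1 v = v"
  by (simp add: one_pCons)

lemma poly_action_add: "poly_action A (p + q) v = poly_action A p v + poly_action A q v"
  by (induction p q rule: poly_induct2)
     (simp_all add: matrix_vector_right_distrib vec.scale_left_distrib algebra_simps)

lemma poly_action_smult: "poly_action A (Polynomial.smult c p) v = c *s poly_action A p v"
  by (induction p)
     (simp_all add: vec.scale_right_distrib vector_scalar_commute vector_smult_assoc)

lemma poly_action_mult: "poly_action A (p * q) v = poly_action A p (poly_action A q v)"
  by (induction p) (simp_all add: poly_action_add poly_action_smult)

lemma poly_action_sum: "poly_action A (sum p S) v = (\<Sum>i\<in>S. poly_action A (p i) v)"
  by (induction S rule: infinite_finite_induct) (simp_all add: poly_action_add)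

lemma poly_action_zero_right [simp]: "poly_action A p 0 = 0"
  by (induction p) simp_all

lemma poly_action_linear_factor: "poly_action A [:- z, 1:] v = A *v v - z *s v"
  by (simp add: vec.scale_minus_left)

lemma poly_action_in_subspace:
  assumes "vec.subspace W" "\<And>w. w \<in> W \<Longrightarrow> A *v w \<in> W" "v \<in> W"
  shows "poly_action A p v \<in> W"
  using assms by (induction p) (auto intro: vec.subspace_0 vec.subspace_add vec.subspace_scale)

text \<open>Write p as (X - z) q. If q(A) v is nonzero, it is an eigenvector for z; otherwise q
  takes the place of p.\<close>

lemma exists_eigenvector_in_subspace:
  assumes "vec.subspace W" "\<And>w. w \<in> W \<Longrightarrow> A *v w \<in> W" "v \<in> W" "v \<noteq> 0"
    and "p \<noteq> 0" "poly_action A p v = 0"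
  shows "\<exists>w\<in>W. \<exists>z. w \<noteq> 0 \<and> A *v w = z *s w"
  using assms(5,6)
proof (induction "Polynomial.degree p" arbitrary: p rule: less_induct)
  case less
  show ?case
  proof (cases "Polynomial.degree p = 0")
    case True
    then obtain a where "p = [:a:]" by (metis degree_eq_zeroE)
    then show ?thesis using less.prems assms(4) by simp
  next
    case False
    then obtain z where "poly p z = 0"
      using fundamental_theorem_of_algebra constant_degree by metis
    then obtain q where q: "p = [:- z, 1:] * q"
      by (metis poly_eq_0_iff_dvd dvdE)
    then have q0: "q \<noteq> 0" using less.prems by auto
    show ?thesis
    proof (cases "poly_action A q v = 0")
      case True
      have "Polynomial.degree q < Polynomial.degree p"
        unfolding q using q0 by (subst degree_mult_eq) auto
      from less.hyps[OF this q0 True] show ?thesis .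
    next
      case False
      have "poly_action A [:- z, 1:] (poly_action A q v) = 0"
        using less.prems(2) by (simp only: q poly_action_mult)
      then have "A *v poly_action A q v = z *s poly_action A q v"
        by (simp only: poly_action_linear_factor right_minus_eq)
      with False poly_action_in_subspace[OF assms(1-3)] show ?thesis by blast
    qed
  qed
qed

text \<open>By induction (A - z) v splits into eigenvectors for the other roots s. Dividing each by
  s - z gives u with (A - z) u = (A - z) v, and v - u is the missing component for z.\<close>

lemma eigenvector_decomposition:
  assumes "finite S" "poly_action A (\<Prod>z\<in>S. [:- z, 1:]) v = 0"
  shows "\<exists>w. (\<forall>z\<in>S. A *v w z = z *s w z) \<and> v = sum w S"
  using assms
proof (induction S arbitrary: v)
  case empty
  then show ?case by simp
next
  case (insert z S)
  have "poly_action A (\<Prod>z\<in>S. [:- z, 1:]) (poly_action A [:- z, 1:] v) = 0"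
    using insert.prems unfolding prod.insert[OF insert.hyps] poly_action_mult[symmetric]
    by (simp only: mult.commute)
  from insert.IH[OF this] obtain w where w: "\<And>s. s \<in> S \<Longrightarrow> A *v w s = s *s w s"
    and sum_w: "poly_action A [:- z, 1:] v = sum w S" by blast
  define u where "u = (\<Sum>s\<in>S. (1 / (s - z)) *s w s)"
  have "A *v u - z *s u = (\<Sum>s\<in>S. A *v ((1 / (s - z)) *s w s) - z *s ((1 / (s - z)) *s w s))"
    by (simp add: u_def vec.linear_sum[OF matrix_vector_mul_linear_gen] vec.scale_sum_right sum_subtractf)
  also have "\<dots> = sum w S"
  proof (rule sum.cong[OF refl])
    fix s assume s: "s \<in> S"
    then have "s - z \<noteq> 0" using insert.hyps by auto
    moreover have "A *v ((1 / (s - z)) *s w s) = (s * (1 / (s - z))) *s w s"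
      unfolding vector_scalar_commute w[OF s] vector_smult_assoc by (simp only: mult.commute)
    then have "A *v ((1 / (s - z)) *s w s) - z *s ((1 / (s - z)) *s w s) = ((s - z) * (1 / (s - z))) *s w s"
      by (simp only: vector_smult_assoc vec.scale_left_diff_distrib left_diff_distrib)
    ultimately show "A *v ((1 / (s - z)) *s w s) - z *s ((1 / (s - z)) *s w s) = w s" by simp
  qed
  finally have u: "A *v u - z *s u = A *v v - z *s v"
    using sum_w by (simp only: poly_action_linear_factor)
  define w' where "w' s = (if s = z then v - u else (1 / (s - z)) *s w s)" for s
  have "A *v w' s = s *s w' s" if "s \<in> insert z S" for s
  proof (cases "s = z")
    case True
    then have "A *v w' s - s *s w' s = (A *v v - z *s v) - (A *v u - z *s u)"
      by (simp add: w'_def matrix_vector_mult_diff_distrib vec.scale_right_diff_distrib)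
    then show ?thesis using u by simp
  next
    case False
    then show ?thesis using that w[of s] unfolding w'_def by (simp add: vector_scalar_commute vector_smult_assoc)
  qed
  moreover have "sum w' S = u"
    unfolding u_def using insert.hyps by (intro sum.cong) (auto simp: w'_def)
  then have "v = sum w' (insert z S)"
    using insert.hyps by (simp add: w'_def)
  ultimately show ?case by blast
qed

lemma scaleR_eq_scalar_mult: "r *\<^sub>R (v :: complex ^ 'n) = complex_of_real r *s v"
  by (simp add: vec_eq_iff scaleR_conv_of_real[where 'a = complex])

text \<open>Distinct linear factors make the eigenvectors span, so a basis can be chosen among them
  and indexed by \<open>'n\<close>. That every \<open>\<alpha> i\<close> has an eigenvector is
  recorded because the arithmetic part starts from it.\<close>

lemma diagonalizable_of_rsquarefree:
  fixes A :: "complex ^ 'n ^ 'n"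
  assumes p: "rsquarefree p" "\<And>v. poly_action A p v = 0"
  obtains c d :: "complex ^ 'n \<Rightarrow> complex ^ 'n" and \<alpha> :: "'n \<Rightarrow> complex" where
    "linear c" "linear d" "\<And>w. c (d w) = w" "\<And>v. d (c v) = v"
    "\<And>v i. c (A *v v) $ i = \<alpha> i * c v $ i" "\<And>i. \<exists>v. v \<noteq> 0 \<and> A *v v = \<alpha> i *s v"
proof -
  define E where "E = {w. \<exists>z. A *v w = z *s w}"
  have p0: "p \<noteq> 0" using p(1) by (simp add: rsquarefree_def)
  have "v \<in> vec.span E" for v
  proof -
    have "poly_action A (Polynomial.smult (Polynomial.lead_coeff p) (\<Prod>z | poly p z = 0. [:- z, 1:])) v = 0"
      using p(2) by (simp only: complex_poly_decompose_rsquarefree[OF p(1)])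
    then have "poly_action A (\<Prod>z | poly p z = 0. [:- z, 1:]) v = 0"
      using p0 by (simp add: poly_action_smult)
    from eigenvector_decomposition[OF poly_roots_finite[OF p0] this] obtain w where
      w: "\<forall>z\<in>{z. poly p z = 0}. A *v w z = z *s w z" "v = sum w {z. poly p z = 0}" by blast
    then show ?thesis unfolding w(2) by (intro vec.span_sum vec.span_base) (auto simp: E_def)
  qed
  then have span_E: "vec.span E = UNIV" by auto
  obtain B where B: "B \<subseteq> E" "vec.independent B" "E \<subseteq> vec.span B"
    using vec.maximal_independent_subset[of E] by blast
  have span_B: "vec.span B = UNIV"
    using B(3) span_E vec.span_minimal[OF B(3) vec.subspace_span] by auto
  have "card B = CARD('n)"
    using vec.dim_eq_card[of B UNIV] B(2) span_B by (simp add: card_cart_basis)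
  moreover have finB: "finite B" using B(2) by (rule vec.independent_bound_general[THEN conjunct1])
  ultimately obtain b where b: "bij_betw b (UNIV :: 'n set) B"
    using finite_same_card_bij[of "UNIV :: 'n set" B] by auto
  have bB: "b i \<in> B" for i using b by (auto simp: bij_betw_def)
  have b_inj: "b i = b j \<longleftrightarrow> i = j" for i j using b by (auto simp: bij_betw_def inj_on_def)
  have "\<exists>z. A *v b i = z *s b i" for i using bB[of i] B(1) by (auto simp: E_def)
  then obtain \<alpha> where \<alpha>: "\<And>i. A *v b i = \<alpha> i *s b i" by metis
  define c where "c v = (\<chi> i. vec.representation B v (b i))" for v
  define d where "d w = (\<Sum>i\<in>UNIV. w $ i *s b i)" for w :: "complex ^ 'n"
  have rep_add: "vec.representation B (v + w) x = vec.representation B v x + vec.representation B w x" for v w x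
    using vec.representation_add[OF B(2), of w v] span_B by (simp add: add.commute)
  have rep_scale: "vec.representation B (a *s v) x = a * vec.representation B v x" for a v x
    using vec.representation_scale[OF B(2), of v a] span_B by simp
  have lin_c: "linear c"
    by (rule linearI) (simp_all add: c_def vec_eq_iff rep_add rep_scale scaleR_eq_scalar_mult)
  have lin_d: "linear d"
    by (rule linearI) (simp_all add: d_def vec.scale_left_distrib sum.distrib scaleR_eq_scalar_mult
        vector_smult_assoc vec.scale_sum_right)
  have dc: "d (c v) = v" for v
  proof -
    have "d (c v) = (\<Sum>x\<in>B. vec.representation B v x *s x)"
      unfolding d_def c_def using b by (simp add: sum.reindex_bij_betw[OF b, symmetric])
    then show ?thesis using vec.sum_representation_eq[OF B(2), of v B] span_B finB by simp
  qed
  have cd: "c (d w) = w" for w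
  proof -
    have "vec.representation B (d w) x = (\<Sum>i\<in>UNIV. w $ i * vec.representation B (b i) x)" for x
      unfolding d_def using vec.representation_sum[OF B(2), of UNIV "\<lambda>i. w $ i *s b i"] span_B
      by (simp add: rep_scale)
    then have "c (d w) $ j = (\<Sum>i\<in>UNIV. if j = i then w $ i else 0)" for j
      unfolding c_def using vec.representation_basis[OF B(2) bB] by (simp add: b_inj if_distrib cong: if_cong)
    then show ?thesis by (simp add: vec_eq_iff)
  qed
  have eig: "c (A *v v) $ i = \<alpha> i * c v $ i" for v i
  proof -
    have "A *v v = A *v d (c v)" by (simp add: dc)
    also have "\<dots> = d (\<chi> i. \<alpha> i * c v $ i)"
      by (simp add: d_def vec.linear_sum[OF matrix_vector_mul_linear_gen] vector_scalar_commute \<alpha>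
          vector_smult_assoc mult.commute[of _ "\<alpha> _"])
    finally show ?thesis by (simp add: cd)
  qed
  have nz: "\<exists>v. v \<noteq> 0 \<and> A *v v = \<alpha> i *s v" for i
  proof (intro exI conjI)
    show "b i \<noteq> 0" using bB[of i] B(2) vec.dependent_zero by metis
    show "A *v b i = \<alpha> i *s b i" by (rule \<alpha>)
  qed
  show ?thesis by (rule that[OF lin_c lin_d cd dc eig nz])
qed

section \<open>Rational polynomials and the rational span of the lattice\<close>

lemma map_poly_of_rat_add:
  "map_poly of_rat (p + q) = map_poly of_rat p + (map_poly of_rat q :: complex poly)"
  by (intro poly_eqI) (simp add: coeff_map_poly of_rat_add)

lemma map_poly_of_rat_mult:
  "map_poly of_rat (p * q) = map_poly of_rat p * (map_poly of_rat q :: complex poly)"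
proof (induction p)
  case (pCons a p)
  have "map_poly of_rat (pCons a p * q) = map_poly of_rat (Polynomial.smult a q) + (map_poly of_rat (pCons 0 (p * q)) :: complex poly)"
    by (simp add: map_poly_of_rat_add)
  then show ?case
    using pCons.IH by (simp add: map_poly_pCons map_poly_smult of_rat_mult)
qed simp

lemma map_poly_of_rat_eq_0_iff: "map_poly of_rat p = (0 :: complex poly) \<longleftrightarrow> p = 0"
  by (simp add: map_poly_eq_0_iff)

lemma pderiv_map_poly_of_rat: "pderiv (map_poly of_rat p) = (map_poly of_rat (pderiv p) :: complex poly)"
  by (intro poly_eqI) (simp add: coeff_pderiv coeff_map_poly of_rat_mult of_rat_add)

text \<open>An irreducible q is coprime to its derivative for degree reasons, and the rational
  Bezout identity excludes a common complex root.\<close>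

lemma rsquarefree_irreducible_rat_poly:
  fixes q :: "rat poly"
  assumes "Factorial_Ring.irreducible q"
  shows "rsquarefree (map_poly of_rat q :: complex poly)"
proof -
  have q0: "q \<noteq> 0" "\<not> is_unit q"
    using assms by (auto simp: Factorial_Ring.irreducible_def)
  then have deg: "0 < Polynomial.degree q"
    by (metis gr0I is_unit_iff_degree)
  have "prime_elem q" using assms by (rule irreducible_imp_prime_elem)
  moreover have "\<not> q dvd pderiv q"
  proof
    assume "q dvd pderiv q"
    moreover have "pderiv q \<noteq> 0" using deg by (simp add: pderiv_eq_0_iff)
    ultimately have "Polynomial.degree q \<le> Polynomial.degree (pderiv q)"
      by (rule dvd_imp_degree_le)
    then show False using deg by (simp add: degree_pderiv)
  qed
  ultimately have "coprime q (pderiv q)" by (rule prime_elem_imp_coprime)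
  then obtain a b where ab: "a * q + b * pderiv q = 1"
    by (metis bezout_coefficients_fst_snd coprime_imp_gcd_eq_1)
  show ?thesis unfolding rsquarefree_roots
  proof (intro allI notI)
    fix z :: complex
    assume "poly (map_poly of_rat q) z = 0 \<and> poly (pderiv (map_poly of_rat q)) z = 0"
    then have "poly (map_poly of_rat (a * q + b * pderiv q)) z = 0"
      by (simp add: map_poly_of_rat_add map_poly_of_rat_mult pderiv_map_poly_of_rat)
    then show False by (simp add: ab)
  qed
qed

text \<open>Peeling off prime factors: if q x kills v, then either x kills v already or q kills the
  nonzero vector x(A) v.\<close>

lemma irreducible_factor_with_kernel:
  fixes p :: "rat poly"
  assumes "p \<noteq> 0" "v \<noteq> 0" "poly_action A (map_poly of_rat p) v = 0"
  obtains q w where "Factorial_Ring.irreducible q" "w \<noteq> 0" "poly_action A (map_poly of_rat q) w = 0"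
proof -
  have "\<exists>q w. Factorial_Ring.irreducible q \<and> w \<noteq> 0 \<and> poly_action A (map_poly of_rat q) w = 0"
    using assms
  proof (induction p rule: prime_divisors_induct)
    case zero
    then show ?case by simp
  next
    case (unit u)
    then obtain u' where "1 = u * u'" by (elim dvdE)
    then have "map_poly of_rat (u' * u) = (1 :: complex poly)" by (simp add: mult.commute)
    then have "v = poly_action A (map_poly of_rat u') (poly_action A (map_poly of_rat u) v)"
      by (simp add: map_poly_of_rat_mult poly_action_mult[symmetric])
    with unit.prems show ?case by simp
  next
    case (factor q x)
    show ?case
    proof (cases "poly_action A (map_poly of_rat x) v = 0")
      case True
      with factor show ?thesis by auto
    next
      case False
      moreover have "Factorial_Ring.irreducible q"
        using factor.hyps by (simp add: prime_elem_imp_irreducible prime_imp_prime_elem)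
      ultimately show ?thesis
        using factor.prems by (auto simp: map_poly_of_rat_mult poly_action_mult)
    qed
  qed
  then show ?thesis using that by blast
qed

lemma poly_action_monom: "poly_action A (Polynomial.monom a k) v = a *s ((*v) A ^^ k) v"
  by (induction k) (simp_all add: monom_0 monom_Suc vector_scalar_commute)

lemma map_poly_of_rat_sum:
  "map_poly of_rat (sum p S) = (\<Sum>i\<in>S. map_poly of_rat (p i) :: complex poly)"
  by (induction S rule: infinite_finite_induct) (simp_all add: map_poly_of_rat_add)

lemma complex_of_real_of_rat: "complex_of_real (of_rat q) = of_rat q"
  by (cases q) (simp add: of_rat_rat)

text \<open>Although A preserves \<Lambda> only up to the denominator n, it preserves the rational
  span of a lattice basis, so the orbit of a basis vector is linearly dependent over the
  rationals.\<close>

lemma rational_relation_of_lattice_endomorphism: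
  fixes A :: "complex ^ 'n ^ 'n"
  assumes \<Lambda>: "lattice_in UNIV \<Lambda>" and n: "0 < n" "\<And>l. l \<in> \<Lambda> \<Longrightarrow> (real n *\<^sub>R A) *v l \<in> \<Lambda>"
  obtains p :: "rat poly" and v where "p \<noteq> 0" "v \<noteq> 0" "poly_action A (map_poly of_rat p) v = 0"
proof -
  interpret rv: vector_space "\<lambda>(q::rat) (v :: complex ^ 'n). (of_rat q :: real) *\<^sub>R v"
    by unfold_locales (simp_all add: of_rat_add of_rat_mult scaleR_left_distrib scaleR_right_distrib)
  obtain B where B: "independent B" "span B = UNIV"
    and L: "\<Lambda> = range (\<lambda>c :: _ \<Rightarrow> int. \<Sum>b\<in>B. real_of_int (c b) *\<^sub>R b)"
    using \<Lambda> by (auto simp: lattice_in_def)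
  have fin: "finite B" using B(1) by (rule independent_imp_finite)
  define U where "U = rv.span B"
  have sub: "rv.subspace U" by (simp add: U_def rv.subspace_span)
  have LU: "l \<in> U" if l: "l \<in> \<Lambda>" for l
  proof -
    obtain c :: "_ \<Rightarrow> int" where "l = (\<Sum>b\<in>B. real_of_int (c b) *\<^sub>R b)" using l L by auto
    also have "\<dots> = (\<Sum>b\<in>B. (of_rat (of_int (c b)) :: real) *\<^sub>R b)" by simp
    also have "\<dots> \<in> U" unfolding U_def by (intro rv.span_sum rv.span_scale rv.span_base)
    finally show ?thesis .
  qed
  have BL: "b \<in> \<Lambda>" if "b \<in> B" for b
  proof -
    have "b = (\<Sum>x\<in>B. if x = b then x else 0)" using that fin by simp
    also have "\<dots> = (\<Sum>x\<in>B. real_of_int (if x = b then 1 else 0) *\<^sub>R x)"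
      by (intro sum.cong) auto
    finally show ?thesis unfolding L by (rule range_eqI[where x = "\<lambda>x. if x = b then 1 else 0"])
  qed
  have "B \<subseteq> {v. A *v v \<in> U}"
  proof
    fix b assume "b \<in> B"
    then have "(of_rat (1 / of_nat n) :: real) *\<^sub>R ((real n *\<^sub>R A) *v b) \<in> U"
      by (intro rv.subspace_scale[OF sub] LU n BL)
    then show "b \<in> {v. A *v v \<in> U}"
      using n(1) by (simp add: matrix_vector_scaleR_left of_rat_divide)
  qed
  moreover have "rv.subspace {v. A *v v \<in> U}"
    by (rule rv.subspaceI)
       (use rv.subspace_0[OF sub] rv.subspace_add[OF sub] rv.subspace_scale[OF sub] in
         \<open>auto simp: matrix_vector_right_distrib matrix_vector_scaleR_right\<close>)
  ultimately have AU: "A *v v \<in> U" if "v \<in> U" for v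
    using rv.span_minimal[of B] that unfolding U_def by blast
  have "B \<noteq> {}"
  proof
    assume "B = {}"
    then have "(1 :: complex ^ 'n) \<in> {0}" using B(2) by (metis UNIV_I span_empty)
    then show False by simp
  qed
  then obtain b where b: "b \<in> B" by blast
  then have b0: "b \<noteq> 0" using B(1) dependent_zero by blast
  define x where "x k = ((*v) A ^^ k) b" for k
  have xU: "x k \<in> U" for k
    by (induction k) (use b AU in \<open>auto simp: x_def U_def rv.span_base\<close>)
  define N where "N = card B"
  show ?thesis
  proof (cases "inj_on x {..N}")
    \<comment> \<open>Dependence is a property of the set of vectors and misses repetitions; a
      repetition gives the relation X^i - X^j.\<close>
    case False
    then obtain i j where ij: "i \<noteq> j" "x i = x j" by (auto simp: inj_on_def)
    define p :: "rat poly" where "p = Polynomial.monom 1 i + Polynomial.monom (- 1) j"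
    have "Polynomial.coeff p i = 1" using ij(1) by (simp add: p_def)
    then have "p \<noteq> 0" by auto
    moreover have "poly_action A (map_poly of_rat p) b = 0"
      using ij(2) by (simp add: p_def map_poly_of_rat_add map_poly_monom poly_action_add poly_action_monom x_def
          vec.scale_minus_left)
    ultimately show ?thesis using that b0 by blast
  next
    case True
    then have "card (x ` {..N}) = N + 1" by (simp add: card_image)
    then have "rv.dependent (x ` {..N})"
      using rv.independent_span_bound[OF fin, of "x ` {..N}"] xU by (auto simp: N_def U_def)
    then obtain u where u: "\<exists>v\<in>x ` {..N}. u v \<noteq> 0" "(\<Sum>v\<in>x ` {..N}. (of_rat (u v) :: real) *\<^sub>R v) = 0"
      by (subst (asm) rv.dependent_finite) auto
    obtain k where k: "k \<le> N" "u (x k) \<noteq> 0" using u(1) by auto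
    define p where "p = (\<Sum>k\<le>N. Polynomial.monom (u (x k)) k)"
    have "Polynomial.coeff p k = u (x k)"
      unfolding p_def coeff_sum using k(1) by simp
    then have "p \<noteq> 0" using k(2) by auto
    moreover have "poly_action A (map_poly of_rat p) b = (\<Sum>k\<le>N. of_rat (u (x k)) *s x k)"
      by (simp add: p_def map_poly_of_rat_sum map_poly_monom poly_action_sum poly_action_monom x_def)
    then have "poly_action A (map_poly of_rat p) b = 0"
      using u(2) by (simp add: sum.reindex[OF True] scaleR_eq_scalar_mult complex_of_real_of_rat)
    ultimately show ?thesis using that b0 by blast
  qed
qed

text \<open>Take a nonzero C-invariant subspace of the z-eigenspace of A of least dimension. By
  commutativity, an eigenspace of x in C inside it is again C-invariant, so by minimality x acts
  there as a scalar. This treats all of C at once, finite or not.\<close>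

lemma common_eigenvector:
  fixes A :: "complex ^ 'n ^ 'n"
  assumes comm: "\<And>x y. x \<in> C \<Longrightarrow> y \<in> C \<Longrightarrow> x ** y = y ** x"
    and alg: "\<And>x. x \<in> C \<Longrightarrow> \<exists>p. p \<noteq> 0 \<and> (\<forall>v. poly_action x p v = 0)"
    and A: "A \<in> C" "v \<noteq> 0" "A *v v = z *s v"
  shows "\<exists>w. w \<noteq> 0 \<and> A *v w = z *s w \<and> (\<forall>x\<in>C. \<exists>c. x *v w = c *s w)"
proof -
  define P where "P W \<longleftrightarrow> vec.subspace W \<and> W \<noteq> {0} \<and> (\<forall>x\<in>C. \<forall>w\<in>W. x *v w \<in> W) \<and> (\<forall>w\<in>W. A *v w = z *s w)" for W
  have comm_v: "x *v (y *v w) = y *v (x *v w)" if "x \<in> C" "y \<in> C" for x y w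
    using comm[OF that] by (simp add: matrix_vector_mul_assoc)
  have eig_sub: "vec.subspace {w \<in> W. x *v w = c *s w}" if "vec.subspace W" for W x c
    using that by (auto simp: vec.subspace_def matrix_vector_right_distrib vec.scale_right_distrib
        vector_scalar_commute vector_smult_assoc mult.commute)
  have "P {w \<in> UNIV. A *v w = z *s w}"
    unfolding P_def
  proof (intro conjI)
    show "{w \<in> UNIV. A *v w = z *s w} \<noteq> {0}" using A(2,3) by auto
    show "\<forall>x\<in>C. \<forall>w\<in>{w \<in> UNIV. A *v w = z *s w}. x *v w \<in> {w \<in> UNIV. A *v w = z *s w}"
      by (auto simp: comm_v[OF A(1)] vector_scalar_commute)
  qed (use eig_sub[OF vec.subspace_UNIV] in auto)
  then obtain W where W: "P W" and min: "\<And>W'. P W' \<Longrightarrow> vec.dim W \<le> vec.dim W'"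
    by (metis ex_has_least_nat)
  have W1: "vec.subspace W" "W \<noteq> {0}" "\<And>x w. x \<in> C \<Longrightarrow> w \<in> W \<Longrightarrow> x *v w \<in> W" "\<And>w. w \<in> W \<Longrightarrow> A *v w = z *s w"
    using W by (auto simp: P_def)
  obtain w where w: "w \<in> W" "w \<noteq> 0" using W1(1,2) vec.subspace_0 by blast
  have "\<exists>c. x *v w = c *s w" if x: "x \<in> C" for x
  proof -
    obtain p where p: "p \<noteq> 0" "\<forall>v. poly_action x p v = 0" using alg[OF x] by blast
    obtain w' c where w': "w' \<in> W" "w' \<noteq> 0" "x *v w' = c *s w'"
      using exists_eigenvector_in_subspace[OF W1(1) W1(3)[OF x] w p(1)] p(2) by blast
    define W' where "W' = {w \<in> W. x *v w = c *s w}"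
    have "P W'"
      unfolding P_def
    proof (intro conjI)
      show "vec.subspace W'" unfolding W'_def by (rule eig_sub[OF W1(1)])
      show "W' \<noteq> {0}" using w' by (auto simp: W'_def)
      show "\<forall>y\<in>C. \<forall>w\<in>W'. y *v w \<in> W'"
        by (auto simp: W'_def W1(3) comm_v[OF x] vector_scalar_commute)
      show "\<forall>w\<in>W'. A *v w = z *s w" using W1(4) by (auto simp: W'_def)
    qed
    then have "W' = W"
      using min by (intro vec.subspace_dim_equal) (auto simp: P_def W1(1) W'_def)
    then show ?thesis using w(1) by (auto simp: W'_def)
  qed
  then show ?thesis using w W1(4) by blast
qed

section \<open>Characters of subrings of the endomorphism algebra\<close>

lemma carrier_End_Q_iff:
  assumes "lattice_in UNIV \<Lambda>"
  shows "A \<in> carrier (End_Q \<Lambda>) \<longleftrightarrow> (\<exists>n::nat. 0 < n \<and> (\<forall>l\<in>\<Lambda>. (real n *\<^sub>R A) *v l \<in> \<Lambda>))"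
  by (simp add: End_Q_def End_torus_iff[OF assms])

lemma End_Q_ops:
  "monoid.mult (End_Q \<Lambda>) = (**)" "one (End_Q \<Lambda>) = mat 1" "ring.zero (End_Q \<Lambda>) = 0" "add (End_Q \<Lambda>) = (+)"
  by (simp_all add: End_Q_def)

text \<open>A ring homomorphism to the complex numbers in terms of matrix operations, on any set D,
  so that characters restrict to subsets; values at matrices outside D other than
  \<open>mat 1\<close> are arbitrary.\<close>

definition character :: "(complex ^ 'n ^ 'n) set \<Rightarrow> (complex ^ 'n ^ 'n \<Rightarrow> complex) \<Rightarrow> bool" where
  "character D \<sigma> \<longleftrightarrow> \<sigma> (mat 1) = 1 \<and>
     (\<forall>x\<in>D. \<forall>y\<in>D. \<sigma> (x + y) = \<sigma> x + \<sigma> y \<and> \<sigma> (x ** y) = \<sigma> x * \<sigma> y)"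

lemma character_subset: "character D \<sigma> \<Longrightarrow> F \<subseteq> D \<Longrightarrow> character F \<sigma>"
  by (auto simp: character_def)

lemma complex_embeddings_iff_character:
  "\<sigma> \<in> complex_embeddings ((End_Q \<Lambda>)\<lparr>carrier := F\<rparr>) \<longleftrightarrow> character F \<sigma>"
  by (auto simp: complex_embeddings_def ring_hom_def ring_of_type_algebra_def End_Q_ops character_def)

text \<open>Division enters as \<open>injective\<close>. Closure is assumed under ring operations
  only, so rational polynomials are evaluated after clearing denominators. Both F and the whole
  endomorphism algebra become instances.\<close>

locale matrix_division_ring =
  fixes \<Lambda> :: "(complex ^ 'n) set" and D :: "(complex ^ 'n ^ 'n) set"
  assumes lattice: "lattice_in UNIV \<Lambda>"
    and D_End: "D \<subseteq> carrier (End_Q \<Lambda>)"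
    and zero: "0 \<in> D" and one: "mat 1 \<in> D"
    and add: "\<And>x y. x \<in> D \<Longrightarrow> y \<in> D \<Longrightarrow> x + y \<in> D"
    and neg: "\<And>x. x \<in> D \<Longrightarrow> - x \<in> D"
    and mult: "\<And>x y. x \<in> D \<Longrightarrow> y \<in> D \<Longrightarrow> x ** y \<in> D"
    and injective: "\<And>x v. x \<in> D \<Longrightarrow> x \<noteq> 0 \<Longrightarrow> x *v v = 0 \<Longrightarrow> v = 0"
begin

lemma character_zero: "character D \<sigma> \<Longrightarrow> \<sigma> 0 = 0"
  using zero unfolding character_def by (metis add_0 add_cancel_left_left)

lemma character_neg: "character D \<sigma> \<Longrightarrow> x \<in> D \<Longrightarrow> \<sigma> (- x) = - \<sigma> x"
  using neg character_zero[of \<sigma>] unfolding character_def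
  by (metis add.right_inverse eq_neg_iff_add_eq_0 add.commute)

lemma nat_multiple: "x \<in> D \<Longrightarrow> real n *\<^sub>R x \<in> D"
  by (induction n) (simp_all add: zero add scaleR_left_distrib)

lemma int_multiple: "x \<in> D \<Longrightarrow> real_of_int k *\<^sub>R x \<in> D"
proof (cases k)
  case (nonneg n)
  then show "x \<in> D \<Longrightarrow> ?thesis" by (simp add: nat_multiple)
next
  case (neg n)
  have "real_of_int k *\<^sub>R x = - (real (Suc n) *\<^sub>R x)" by (simp add: neg algebra_simps)
  then show "x \<in> D \<Longrightarrow> ?thesis" using nat_multiple[of x "Suc n"] matrix_division_ring_axioms
    by (simp add: matrix_division_ring.neg del: of_nat_Suc)
qed

lemma character_nat_multiple:
  "character D \<sigma> \<Longrightarrow> x \<in> D \<Longrightarrow> \<sigma> (real n *\<^sub>R x) = of_nat n * \<sigma> x"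
proof (induction n)
  case (Suc n)
  have "\<sigma> (x + real n *\<^sub>R x) = \<sigma> x + \<sigma> (real n *\<^sub>R x)"
    using Suc.prems nat_multiple[of x n] by (simp add: character_def)
  then show ?case using Suc by (simp add: scaleR_left_distrib algebra_simps)
qed (simp add: character_zero)

lemma character_int_multiple:
  assumes "character D \<sigma>" "x \<in> D"
  shows "\<sigma> (real_of_int k *\<^sub>R x) = of_int k * \<sigma> x"
proof (cases k)
  case (nonneg n)
  then show ?thesis by (simp add: character_nat_multiple assms)
next
  case (neg n)
  have "real_of_int k *\<^sub>R x = - (real (Suc n) *\<^sub>R x)" by (simp add: neg algebra_simps)
  then have "\<sigma> (real_of_int k *\<^sub>R x) = - (of_nat (Suc n) * \<sigma> x)"
    using nat_multiple[of x "Suc n"] assms by (simp only: character_neg character_nat_multiple)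
  then show ?thesis by (simp add: neg ring_distribs)
qed

text \<open>A multiple d q(x) lies in D. The action on vectors and the values of all characters are
  tracked together, so that y = 0 later yields both that q annihilates x and that every \<sigma> x
  is a root of q.\<close>

lemma poly_action_denominator:
  fixes q :: "rat poly"
  assumes x: "x \<in> D"
  shows "\<exists>d::int. 0 < d \<and> (\<exists>y\<in>D. (\<forall>v. y *v v = of_int d *s poly_action x (map_poly of_rat q) v) \<and>
    (\<forall>\<sigma>. character D \<sigma> \<longrightarrow> \<sigma> y = of_int d * poly (map_poly of_rat q) (\<sigma> x)))"
proof (induction q)
  case 0
  then show ?case using zero character_zero by (intro exI[of _ 1] conjI bexI[of _ 0]) auto
next
  case (pCons a q)
  then obtain d y where d: "0 < d" and y: "y \<in> D" "\<And>v. y *v v = of_int d *s poly_action x (map_poly of_rat q) v"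
    "\<And>\<sigma>. character D \<sigma> \<Longrightarrow> \<sigma> y = of_int d * poly (map_poly of_rat q) (\<sigma> x)" by blast
  obtain i e :: int where a: "a = of_int i / of_int e" "0 < e"
    by (metis quotient_of_div quotient_of_denom_pos surj_pair)
  have ea: "complex_of_int e * of_rat a = of_int i" using a by (simp add: of_rat_divide)
  \<comment> \<open>With a = i / e, this is d e (a + x q(x)), where y stands for d q(x).\<close>
  define y' where "y' = real_of_int (d * i) *\<^sub>R mat 1 + real_of_int e *\<^sub>R (x ** y)"
  have "y' *v v = of_int (d * e) *s poly_action x (map_poly of_rat (pCons a q)) v" for v
  proof -
    have "y' *v v = of_int (d * i) *s v + of_int e *s (x *v (of_int d *s poly_action x (map_poly of_rat q) v))"
      by (simp add: y'_def matrix_vector_mult_add_rdistrib matrix_vector_scaleR_left scaleR_eq_scalar_mult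
          matrix_vector_mul_assoc[symmetric] y(2) del: of_int_mult)
    also have "of_int (d * i) = of_int (d * e) * (of_rat a :: complex)"
      by (simp add: ea[symmetric])
    finally show ?thesis
      by (simp add: map_poly_pCons vector_scalar_commute vector_smult_assoc vec.scale_right_distrib mult.commute)
  qed
  moreover have "\<sigma> y' = of_int (d * e) * poly (map_poly of_rat (pCons a q)) (\<sigma> x)" if \<sigma>: "character D \<sigma>" for \<sigma>
  proof -
    have "\<sigma> y' = \<sigma> (real_of_int (d * i) *\<^sub>R mat 1) + \<sigma> (real_of_int e *\<^sub>R (x ** y))"
      unfolding y'_def using \<sigma> int_multiple[OF one] int_multiple[OF mult[OF x y(1)]] unfolding character_def by blast
    also have "\<dots> = of_int (d * i) * \<sigma> (mat 1) + of_int e * \<sigma> (x ** y)"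
      by (simp only: character_int_multiple[OF \<sigma> one] character_int_multiple[OF \<sigma> mult[OF x y(1)]])
    also have "\<sigma> (mat 1) = 1" using \<sigma> by (simp add: character_def)
    also have "\<sigma> (x ** y) = \<sigma> x * \<sigma> y" using \<sigma> x y(1) by (simp add: character_def)
    also have "of_int (d * i) * 1 = of_int (d * e) * (of_rat a :: complex)"
      by (simp add: ea[symmetric])
    finally show ?thesis by (simp add: map_poly_pCons y(3)[OF \<sigma>] algebra_simps)
  qed
  moreover have "y' \<in> D" unfolding y'_def by (intro add int_multiple one mult x y(1))
  ultimately show ?case using d a(2) by (intro exI[of _ "d * e"] conjI bexI[of _ y']) auto
qed

text \<open>Some irreducible q has q(x) w = 0 with w nonzero. A multiple of q(x) lies in D and is
  not injective, hence is 0.\<close>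

lemma irreducible_annihilator:
  assumes x: "x \<in> D"
  obtains q :: "rat poly" where "Factorial_Ring.irreducible q"
    "\<And>v. poly_action x (map_poly of_rat q) v = 0"
    "\<And>\<sigma>. character D \<sigma> \<Longrightarrow> poly (map_poly of_rat q) (\<sigma> x) = 0"
proof -
  obtain n :: nat where "0 < n" "\<And>l. l \<in> \<Lambda> \<Longrightarrow> (real n *\<^sub>R x) *v l \<in> \<Lambda>"
    using x D_End carrier_End_Q_iff[OF lattice] by blast
  from rational_relation_of_lattice_endomorphism[OF lattice this]
  obtain p :: "rat poly" and v where "p \<noteq> 0" "v \<noteq> 0" "poly_action x (map_poly of_rat p) v = 0" by blast
  from irreducible_factor_with_kernel[OF this]
  obtain q w where q: "Factorial_Ring.irreducible q" "w \<noteq> 0" "poly_action x (map_poly of_rat q) w = 0" by blast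
  obtain d :: int and y where d: "0 < d" and y: "y \<in> D"
    "\<And>v. y *v v = of_int d *s poly_action x (map_poly of_rat q) v"
    "\<And>\<sigma>. character D \<sigma> \<Longrightarrow> \<sigma> y = of_int d * poly (map_poly of_rat q) (\<sigma> x)"
    using poly_action_denominator[OF x, of q] by blast
  have y0: "y = 0" using injective[OF y(1), of w] q(2,3) y(2)[of w] by auto
  show ?thesis
  proof (rule that[OF q(1)])
    show "poly_action x (map_poly of_rat q) v = 0" for v
      using y(2)[of v] d by (simp add: y0)
    show "poly (map_poly of_rat q) (\<sigma> x) = 0" if "character D \<sigma>" for \<sigma>
      using y(3)[OF that] d character_zero[OF that] by (simp add: y0)
  qed
qed

lemma algebraic_element: "x \<in> D \<Longrightarrow> \<exists>p. p \<noteq> 0 \<and> (\<forall>v. poly_action x p v = 0)"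
  by (metis irreducible_annihilator rsquarefree_irreducible_rat_poly rsquarefree_def)

text \<open>Both \<sigma> x and \<tau> x are roots of one irreducible rational polynomial; it has
  the root \<tau> x in L, so it splits there, and \<sigma> x is among its roots.\<close>

lemma character_value_in_normal:
  assumes x: "x \<in> D" and \<sigma>: "character D \<sigma>" and \<tau>: "character D \<tau>" "\<tau> x \<in> L" and L: "normal_over_rat L"
  shows "\<sigma> x \<in> L"
proof -
  obtain q :: "rat poly" where q: "Factorial_Ring.irreducible q"
    "\<And>\<sigma>. character D \<sigma> \<Longrightarrow> poly (map_poly of_rat q) (\<sigma> x) = 0"
    using irreducible_annihilator[OF x] by metis
  obtain c as where as: "set as \<subseteq> L" "map_poly of_rat q = Polynomial.smult c (\<Prod>a\<leftarrow>as. [:- a, 1:])"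
    using L q(1) q(2)[OF \<tau>(1)] \<tau>(2) unfolding normal_over_rat_def by metis
  have "q \<noteq> 0" using q(1) by auto
  then have "c \<noteq> 0" using as(2) by (auto simp: map_poly_of_rat_eq_0_iff)
  with q(2)[OF \<sigma>] have "prod_list (map (\<lambda>a. \<sigma> x - a) as) = 0"
    unfolding as(2) using poly_prod_list[of "map (\<lambda>a. [:- a, 1:]) as" "\<sigma> x"] by (simp add: o_def)
  then have "\<sigma> x \<in> set as" by (auto simp: prod_list_zero_iff)
  then show ?thesis using as(1) by blast
qed

lemma character_of_common_eigenvector:
  assumes "w \<noteq> 0" "\<And>x. x \<in> D \<Longrightarrow> x *v w = \<sigma> x *s w"
  shows "character D \<sigma>"
proof -
  have eq: "a = b" if "a *s w = b *s w" for a b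
    using that assms(1) by (simp add: vec.scale_right_imp_eq)
  have "\<sigma> (x + y) = \<sigma> x + \<sigma> y" if "x \<in> D" "y \<in> D" for x y
    by (rule eq) (simp add: assms(2)[symmetric] that add matrix_vector_mult_add_rdistrib vec.scale_left_distrib)
  moreover have "\<sigma> (x ** y) = \<sigma> x * \<sigma> y" if "x \<in> D" "y \<in> D" for x y
  proof (rule eq)
    have "\<sigma> (x ** y) *s w = x *v (y *v w)"
      using assms(2)[OF mult[OF that]] by (simp add: matrix_vector_mul_assoc)
    also have "\<dots> = (\<sigma> x * \<sigma> y) *s w"
      by (simp add: assms(2) that vector_scalar_commute vector_smult_assoc mult.commute)
    finally show "\<sigma> (x ** y) *s w = (\<sigma> x * \<sigma> y) *s w" .
  qed
  moreover have "\<sigma> (mat 1) = 1" by (rule eq) (simp add: assms(2)[OF one, symmetric])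
  ultimately show ?thesis by (simp add: character_def)
qed

text \<open>C need only be a commuting set: for quaternions it is \<open>insert A F\<close>, and
  \<sigma> becomes a character after restriction to F.\<close>

lemma eigenvalue_character:
  assumes "C \<subseteq> D" "\<And>x y. x \<in> C \<Longrightarrow> y \<in> C \<Longrightarrow> x ** y = y ** x"
    and "A \<in> C" "v \<noteq> 0" "A *v v = z *s v"
  shows "\<exists>w \<sigma>. w \<noteq> 0 \<and> \<sigma> A = z \<and> (\<forall>x\<in>C. x *v w = \<sigma> x *s w)"
proof -
  have alg: "\<exists>p. p \<noteq> 0 \<and> (\<forall>v. poly_action x p v = 0)" if "x \<in> C" for x
    using that assms(1) by (intro algebraic_element) auto
  obtain w where w: "w \<noteq> 0" "A *v w = z *s w" "\<forall>x\<in>C. \<exists>c. x *v w = c *s w"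
    using common_eigenvector[OF assms(2) alg assms(3-5)] by blast
  obtain \<sigma> where \<sigma>: "\<And>x. x \<in> C \<Longrightarrow> x *v w = \<sigma> x *s w" using w(3) by metis
  have "\<sigma> A *s w = z *s w" using \<sigma>[OF assms(3)] w(2) by metis
  then have "\<sigma> A = z" using w(1) by auto
  with w(1) \<sigma> show ?thesis by blast
qed

end

lemma subfield_matrix_division_ring:
  assumes "lattice_in UNIV \<Lambda>" "ring (End_Q \<Lambda>)" "subfield F (End_Q \<Lambda>)"
  shows "matrix_division_ring \<Lambda> F"
proof -
  interpret E: ring "End_Q \<Lambda>" by fact
  note sub = subringE[OF subfieldE(1)[OF assms(3)], unfolded End_Q_ops]
  show ?thesis
  proof
    show "- x \<in> F" if x: "x \<in> F" for x
    proof -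
      have "x \<oplus>\<^bsub>End_Q \<Lambda>\<^esub> (\<ominus>\<^bsub>End_Q \<Lambda>\<^esub> x) = \<zero>\<^bsub>End_Q \<Lambda>\<^esub>" using x sub(1) by (intro E.r_neg) auto
      then have "\<ominus>\<^bsub>End_Q \<Lambda>\<^esub> x = - x" by (simp add: End_Q_ops eq_neg_iff_add_eq_0 add.commute)
      then show ?thesis using sub(5)[OF x] by simp
    qed
    show "v = 0" if "x \<in> F" "x \<noteq> 0" "x *v v = 0" for x v
    proof -
      have "inv\<^bsub>End_Q \<Lambda>\<^esub> x \<otimes>\<^bsub>End_Q \<Lambda>\<^esub> x = \<one>\<^bsub>End_Q \<Lambda>\<^esub>"
        using that by (intro E.subfield_m_inv(3)[OF assms(3)]) (simp add: End_Q_ops)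
      then have "v = (inv\<^bsub>End_Q \<Lambda>\<^esub> x ** x) *v v" by (simp add: End_Q_ops)
      then show ?thesis using that(3) by (simp add: matrix_vector_mul_assoc[symmetric])
    qed
  qed (use assms(1) sub in auto)
qed

section \<open>Absolute values of eigenvalues\<close>

lemma minus_ring_of_type_algebra: "x \<ominus>\<^bsub>ring_of_type_algebra\<^esub> y = (x - y :: real)"
proof -
  interpret R: ring "ring_of_type_algebra :: real ring" by (rule ring_from_type_algebra)
  have "\<ominus>\<^bsub>ring_of_type_algebra\<^esub> y = - y"
    by (rule R.minus_equality) (simp_all add: ring_of_type_algebra_def)
  then show ?thesis by (simp add: a_minus_def) (simp add: ring_of_type_algebra_def)
qed

lemma quaternion_mult_real:
  "quaternion_mult (ring_of_type_algebra :: real ring) a b (x0, x1, x2, x3) (y0, y1, y2, y3) =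
    (x0 * y0 + a * (x1 * y1) + b * (x2 * y2) - a * b * (x3 * y3),
     x0 * y1 + x1 * y0 + b * (x3 * y2) - b * (x2 * y3),
     x0 * y2 + x2 * y0 + a * (x1 * y3) - a * (x3 * y1),
     x0 * y3 + x3 * y0 + x1 * y2 - x2 * y1)"
  by (simp add: minus_ring_of_type_algebra) (simp add: ring_of_type_algebra_def)

text \<open>Multiplicativity of the norm, that is, Euler's four-square identity.\<close>

lemma hamilton_no_zero_divisors:
  assumes "quaternion_mult (ring_of_type_algebra :: real ring) (- 1) (- 1) x y = (0, 0, 0, 0)"
  shows "x = (0, 0, 0, 0) \<or> y = (0, 0, 0, 0)"
proof -
  obtain x0 x1 x2 x3 y0 y1 y2 y3 where xy: "x = (x0, x1, x2, x3)" "y = (y0, y1, y2, y3)"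
    by (metis prod_cases4)
  have eqs: "x0 * y0 - x1 * y1 - x2 * y2 - x3 * y3 = 0" "x0 * y1 + x1 * y0 - x3 * y2 + x2 * y3 = 0"
    "x0 * y2 + x2 * y0 - x1 * y3 + x3 * y1 = 0" "x0 * y3 + x3 * y0 + x1 * y2 - x2 * y1 = 0"
    using assms unfolding xy quaternion_mult_real by simp_all
  have "(x0\<^sup>2 + x1\<^sup>2 + x2\<^sup>2 + x3\<^sup>2) * (y0\<^sup>2 + y1\<^sup>2 + y2\<^sup>2 + y3\<^sup>2) =
      (x0 * y0 - x1 * y1 - x2 * y2 - x3 * y3)\<^sup>2 + (x0 * y1 + x1 * y0 - x3 * y2 + x2 * y3)\<^sup>2 +
      (x0 * y2 + x2 * y0 - x1 * y3 + x3 * y1)\<^sup>2 + (x0 * y3 + x3 * y0 + x1 * y2 - x2 * y1)\<^sup>2"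
    by (simp add: power2_eq_square algebra_simps)
  then have "x0\<^sup>2 + x1\<^sup>2 + x2\<^sup>2 + x3\<^sup>2 = 0 \<or> y0\<^sup>2 + y1\<^sup>2 + y2\<^sup>2 + y3\<^sup>2 = 0"
    unfolding eqs by simp
  then show ?thesis
    by (auto simp: xy add_nonneg_eq_0_iff)
qed

text \<open>If a > 0, then (sqrt a + i)(sqrt a - i) = 0 gives zero divisors, which the Hamilton
  quaternions do not have; likewise with b and j.\<close>

lemma quaternion_iso_hamilton_negative:
  assumes iso: "quaternion_algebra (ring_of_type_algebra :: real ring) a b \<simeq> hamilton_quaternions"
  shows "a \<le> 0" "b \<le> 0"
proof -
  obtain g where g: "g \<in> ring_iso (quaternion_algebra (ring_of_type_algebra :: real ring) a b) hamilton_quaternions"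
    using iso by (auto simp: is_ring_iso_def)
  have UNIV: "carrier (quaternion_algebra (ring_of_type_algebra :: real ring) r s) = UNIV" for r s
    by (simp add: quaternion_algebra_def ring_of_type_algebra_def)
  have g_mult: "g (quaternion_mult ring_of_type_algebra a b x y) =
      quaternion_mult ring_of_type_algebra (- 1) (- 1) (g x) (g y)" for x y
    using ring_iso_memE(2)[OF g, of x y] by (simp add: UNIV) (simp add: quaternion_algebra_def)
  have g_add: "g (quaternion_add ring_of_type_algebra x y) = quaternion_add ring_of_type_algebra (g x) (g y)" for x y
    using ring_iso_memE(3)[OF g, of x y] by (simp add: UNIV) (simp add: quaternion_algebra_def)
  have add: "quaternion_add (ring_of_type_algebra :: real ring) (x0, x1, x2, x3) (y0, y1, y2, y3) =
      (x0 + y0, x1 + y1, x2 + y2, x3 + y3)" for x0 x1 x2 x3 y0 y1 y2 y3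
    by (simp add: ring_of_type_algebra_def)
  have "inj g" using ring_iso_memE(5)[OF g] by (simp add: UNIV bij_betw_def)
  obtain z0 z1 z2 z3 where z: "g (0, 0, 0, 0) = (z0, z1, z2, z3)" by (metis prod_cases4)
  have g0: "g (0, 0, 0, 0) = (0, 0, 0, 0)"
    using g_add[of "(0, 0, 0, 0)" "(0, 0, 0, 0)"] unfolding add z by (simp add: z)
  have no_zero_div: "x = (0, 0, 0, 0) \<or> y = (0, 0, 0, 0)"
    if "quaternion_mult ring_of_type_algebra a b x y = (0, 0, 0, 0)" for x y
    using hamilton_no_zero_divisors[of "g x" "g y"] g_mult[of x y] that g0 \<open>inj g\<close>
    by (metis injD)
  show "a \<le> 0"
  proof (rule ccontr)
    assume "\<not> a \<le> 0"
    then have "quaternion_mult ring_of_type_algebra a b (sqrt a, 1, 0, 0) (sqrt a, - 1, 0, 0) = (0, 0, 0, 0)"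
      unfolding quaternion_mult_real by simp
    from no_zero_div[OF this] show False by simp
  qed
  show "b \<le> 0"
  proof (rule ccontr)
    assume "\<not> b \<le> 0"
    then have "quaternion_mult ring_of_type_algebra a b (sqrt b, 0, 1, 0) (sqrt b, 0, - 1, 0) = (0, 0, 0, 0)"
      unfolding quaternion_mult_real by simp
    from no_zero_div[OF this] show False by simp
  qed
qed

text \<open>The other root of a nonreal z is its conjugate, so the product m of the roots is the
  absolute square. A real z with nonpositive discriminant is a double root, so m is its
  square.\<close>

lemma quadratic_root_norm:
  fixes z s m :: complex
  assumes "z * z = s * z - m" "s \<in> \<real>" "m \<in> \<real>" "z \<notin> \<real> \<or> (\<exists>r\<le>0. s * s - 4 * m = complex_of_real r)"
  shows "complex_of_real ((cmod z)\<^sup>2) = m"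
proof -
  obtain s' m' where sm: "s = complex_of_real s'" "m = complex_of_real m'"
    using assms(2,3) by (auto elim!: Reals_cases)
  have re: "Re z * Re z - Im z * Im z = s' * Re z - m'" and im: "2 * (Re z * Im z) = s' * Im z"
    using assms(1) by (simp_all add: complex_eq_iff sm)
  have "(Re z)\<^sup>2 + (Im z)\<^sup>2 = m'"
  proof (cases "Im z = 0")
    case False
    then have "s' = 2 * Re z" using im by simp
    then show ?thesis using re by (simp add: power2_eq_square)
  next
    case True
    then have "z \<in> \<real>" by (simp add: complex_is_Real_iff)
    then obtain r where "r \<le> 0" "s * s - 4 * m = complex_of_real r" using assms(4) by blast
    then have "s' * s' - 4 * m' \<le> 0" by (simp add: sm complex_eq_iff)
    moreover have "(2 * Re z - s')\<^sup>2 = s' * s' - 4 * m'"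
      using re True by (simp add: power2_eq_square algebra_simps)
    ultimately have "2 * Re z - s' = 0" by (metis power2_less_eq_zero_iff)
    then have "s' = 2 * Re z" by simp
    then show ?thesis using re True by (simp add: power2_eq_square)
  qed
  then show ?thesis by (simp add: sm cmod_power2)
qed

lemma real_square_norm: "z \<in> \<real> \<Longrightarrow> complex_of_real ((cmod z)\<^sup>2) = z * z"
  by (auto elim!: Reals_cases simp: power2_eq_square of_real_mult[symmetric] simp del: of_real_mult)

section \<open>Absolute squares of eigenvalues in the three types of algebra\<close>

lemma totally_real_character:
  fixes \<Lambda> :: "(complex ^ 'n) set"
  assumes "totally_real_field ((End_Q \<Lambda>)\<lparr>carrier := F\<rparr>)" "character F \<sigma>" "x \<in> F"
  shows "\<sigma> x \<in> \<real>"
  using assms complex_embeddings_iff_character[of \<sigma> F \<Lambda>] by (auto simp: totally_real_field_def)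

context
  fixes \<Lambda> :: "(complex ^ 'n) set"
  assumes lattice: "lattice_in UNIV \<Lambda>" and ring: "ring (End_Q \<Lambda>)"
begin

text \<open>The common interface of the three cases; both m and \<sigma> may depend on the
  eigenvalue.\<close>

definition norm_realizing :: "(complex ^ 'n ^ 'n) set \<Rightarrow> bool" where
  "norm_realizing F \<longleftrightarrow>
     (\<forall>A\<in>carrier (End_Q \<Lambda>). \<forall>z v. v \<noteq> 0 \<and> A *v v = z *s v \<longrightarrow>
        (\<exists>m\<in>F. \<exists>\<sigma>. character F \<sigma> \<and> \<sigma> m = complex_of_real ((cmod z)\<^sup>2)))"

lemma End_Q_field:
  assumes "Ring.field (End_Q \<Lambda>)"
  shows "matrix_division_ring \<Lambda> (carrier (End_Q \<Lambda>))"
    "\<And>x y. x \<in> carrier (End_Q \<Lambda>) \<Longrightarrow> y \<in> carrier (End_Q \<Lambda>) \<Longrightarrow> x ** y = y ** x"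
proof -
  have sub: "subfield (carrier (End_Q \<Lambda>)) (End_Q \<Lambda>)"
    by (rule field.carrier_is_subfield[OF assms])
  show "matrix_division_ring \<Lambda> (carrier (End_Q \<Lambda>))"
    by (rule subfield_matrix_division_ring[OF lattice ring sub])
  show "x ** y = y ** x" if "x \<in> carrier (End_Q \<Lambda>)" "y \<in> carrier (End_Q \<Lambda>)" for x y
    using subfieldE(4)[OF sub that] by (simp add: End_Q_ops)
qed

lemma norm_realizing_totally_real:
  assumes real: "totally_real_field (End_Q \<Lambda>)"
  shows "norm_realizing (carrier (End_Q \<Lambda>))"
proof -
  have "Ring.field (End_Q \<Lambda>)" using real by (simp add: totally_real_field_def number_field_def)
  note K = End_Q_field[OF this]
  interpret K: matrix_division_ring \<Lambda> "carrier (End_Q \<Lambda>)" by (rule K(1))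
  show ?thesis
    unfolding norm_realizing_def
  proof (intro ballI allI impI, elim conjE)
    fix A z and v :: "complex ^ 'n"
    assume A: "A \<in> carrier (End_Q \<Lambda>)" "v \<noteq> 0" "A *v v = z *s v"
    obtain w \<sigma> where w: "w \<noteq> 0" "\<sigma> A = z" "\<And>x. x \<in> carrier (End_Q \<Lambda>) \<Longrightarrow> x *v w = \<sigma> x *s w"
      using K.eigenvalue_character[OF subset_refl K(2) A] by metis
    have \<sigma>: "character (carrier (End_Q \<Lambda>)) \<sigma>"
      by (rule K.character_of_common_eigenvector[OF w(1,3)])
    then have "\<sigma> A \<in> \<real>" using totally_real_character[of "carrier (End_Q \<Lambda>)" \<Lambda>] real A(1) by simp
    then have "\<sigma> (A ** A) = complex_of_real ((cmod z)\<^sup>2)"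
      using \<sigma> A(1) w(2) real_square_norm[of z] by (simp add: character_def)
    then show "\<exists>m\<in>carrier (End_Q \<Lambda>). \<exists>\<sigma>. character (carrier (End_Q \<Lambda>)) \<sigma> \<and> \<sigma> m = complex_of_real ((cmod z)\<^sup>2)"
      using \<sigma> K.mult[OF A(1) A(1)] by blast
  qed
qed

text \<open>For A outside F, the elements 1 and A form an F-basis, and A satisfies a quadratic
  equation over F whose constant term is the relative norm of A.\<close>

lemma norm_realizing_CM:
  assumes CM: "CM_field_over F (End_Q \<Lambda>)"
  shows "norm_realizing F"
proof -
  have "Ring.field (End_Q \<Lambda>)" and F: "subfield F (End_Q \<Lambda>)"
    and real: "totally_real_field ((End_Q \<Lambda>)\<lparr>carrier := F\<rparr>)"
    and dim: "ring.dimension (End_Q \<Lambda>) 2 F (carrier (End_Q \<Lambda>))"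
    and imag: "\<And>\<sigma>. \<sigma> \<in> complex_embeddings (End_Q \<Lambda>) \<Longrightarrow> \<not> \<sigma> ` carrier (End_Q \<Lambda>) \<subseteq> \<real>"
    using CM by (auto simp: CM_field_over_def totally_imaginary_field_def number_field_def)
  note K = End_Q_field[OF this(1)]
  interpret K: matrix_division_ring \<Lambda> "carrier (End_Q \<Lambda>)" by (rule K(1))
  interpret F: matrix_division_ring \<Lambda> F by (rule subfield_matrix_division_ring[OF lattice ring F])
  interpret R: ring "End_Q \<Lambda>" by (rule ring)
  have FK: "F \<subseteq> carrier (End_Q \<Lambda>)" by (rule F.D_End)
  show ?thesis
    unfolding norm_realizing_def
  proof (intro ballI allI impI, elim conjE)
    fix A z and v :: "complex ^ 'n"
    assume A: "A \<in> carrier (End_Q \<Lambda>)" "v \<noteq> 0" "A *v v = z *s v"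
    obtain w \<sigma> where w: "w \<noteq> 0" "\<sigma> A = z" "\<And>x. x \<in> carrier (End_Q \<Lambda>) \<Longrightarrow> x *v w = \<sigma> x *s w"
      using K.eigenvalue_character[OF subset_refl K(2) A] by metis
    have \<sigma>: "character (carrier (End_Q \<Lambda>)) \<sigma>"
      by (rule K.character_of_common_eigenvector[OF w(1,3)])
    have \<sigma>F: "character F \<sigma>" using character_subset[OF \<sigma> FK] .
    have \<sigma>_real: "\<sigma> x \<in> \<real>" if "x \<in> F" for x by (rule totally_real_character[OF real \<sigma>F that])
    have "\<exists>m\<in>F. \<sigma> m = complex_of_real ((cmod z)\<^sup>2)"
    proof (cases "A \<in> F")
      case True
      then have "\<sigma> (A ** A) = complex_of_real ((cmod z)\<^sup>2)"
        using \<sigma>F \<sigma>_real[OF True] w(2) real_square_norm[of z] by (simp add: character_def)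
      then show ?thesis using F.mult[OF True True] by blast
    next
      case False
      have Span_1: "R.Span F [\<one>\<^bsub>End_Q \<Lambda>\<^esub>] = F"
        by (auto simp: R.line_extension_mem_iff set_eq_iff End_Q_ops)
      have "R.independent F [A, \<one>\<^bsub>End_Q \<Lambda>\<^esub>]"
      proof (intro R.li_Cons R.li_Nil)
        show "A \<notin> R.Span F [\<one>\<^bsub>End_Q \<Lambda>\<^esub>]" using False Span_1 by simp
        show "\<one>\<^bsub>End_Q \<Lambda>\<^esub> \<notin> R.Span F []" using subfieldE(6)[OF F] by simp
      qed (use A(1) in auto)
      then have "R.Span F [A, \<one>\<^bsub>End_Q \<Lambda>\<^esub>] = carrier (End_Q \<Lambda>)"
        by (rule R.independent_length_eq_dimension[OF F dim, THEN iffD1]) (use A(1) K.one in \<open>auto simp: End_Q_ops\<close>)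
      then have "carrier (End_Q \<Lambda>) = R.line_extension F A F"
        using Span_1 by simp
      then have gen: "\<exists>p\<in>F. \<exists>q\<in>F. x = p ** A + q" if "x \<in> carrier (End_Q \<Lambda>)" for x
        using that by (auto simp: R.line_extension_mem_iff End_Q_ops)
      have \<sigma>_gen: "\<sigma> (p ** A + q) = \<sigma> p * z + \<sigma> q" if "p \<in> F" "q \<in> F" for p q
        using \<sigma> that FK A(1) K.mult[of p A] w(2) by (auto simp: character_def subset_iff)
      obtain p q where pq: "p \<in> F" "q \<in> F" "A ** A = p ** A + q"
        using gen[OF K.mult[OF A(1) A(1)]] by blast
      have "\<sigma> (A ** A) = z * z" using \<sigma> A(1) w(2) by (simp add: character_def)
      then have "z * z = \<sigma> p * z + \<sigma> q"
        using \<sigma>_gen[OF pq(1,2)] pq(3) by simp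
      then have "z * z = \<sigma> p * z - \<sigma> (- q)"
        using F.character_neg[OF \<sigma>F pq(2)] by simp
      \<comment> \<open>With z real, \<sigma> would map the whole field, generated over F by 1 and
        A, into the reals, against total imaginarity.\<close>
      moreover have "z \<notin> \<real>"
      proof
        assume z: "z \<in> \<real>"
        have "\<sigma> x \<in> \<real>" if "x \<in> carrier (End_Q \<Lambda>)" for x
          using gen[OF that] \<sigma>_gen \<sigma>_real z by auto
        then show False
          using imag[of \<sigma>] complex_embeddings_iff_character[of \<sigma> "carrier (End_Q \<Lambda>)" \<Lambda>] \<sigma> by auto
      qed
      ultimately have "complex_of_real ((cmod z)\<^sup>2) = \<sigma> (- q)"
        using \<sigma>_real pq F.neg by (intro quadratic_root_norm) auto
      then show ?thesis using F.neg[OF pq(2)] by (intro bexI[of _ "- q"]) auto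
    qed
    then show "\<exists>m\<in>F. \<exists>\<sigma>. character F \<sigma> \<and> \<sigma> m = complex_of_real ((cmod z)\<^sup>2)"
      using \<sigma>F by blast
  qed
qed

text \<open>A is a root of X^2 - t X + m with t its reduced trace and m its reduced norm. The
  discriminant is 4 (a x1^2 + b x2^2 - a b x3^2), nonpositive under every embedding because a and b
  become negative; the same signs make the norm form anisotropic.\<close>

lemma totally_definite_quaternion:
  assumes quat: "totally_definite_quaternion_algebra_over F (End_Q \<Lambda>)"
  shows "matrix_division_ring \<Lambda> (carrier (End_Q \<Lambda>))" "norm_realizing F"
proof -
  have F: "subfield F (End_Q \<Lambda>)" and real: "totally_real_field ((End_Q \<Lambda>)\<lparr>carrier := F\<rparr>)"
    using quat by (auto simp: totally_definite_quaternion_algebra_over_def)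
  obtain a b h where ab': "a \<in> F - {\<zero>\<^bsub>End_Q \<Lambda>\<^esub>}" "b \<in> F - {\<zero>\<^bsub>End_Q \<Lambda>\<^esub>}"
    and h: "h \<in> ring_iso (End_Q \<Lambda>) (quaternion_algebra ((End_Q \<Lambda>)\<lparr>carrier := F\<rparr>) a b)"
    and hF': "\<forall>c\<in>F. h c = (c, \<zero>\<^bsub>End_Q \<Lambda>\<^esub>, \<zero>\<^bsub>End_Q \<Lambda>\<^esub>, \<zero>\<^bsub>End_Q \<Lambda>\<^esub>)"
    and definite: "\<forall>\<sigma>\<in>real_embeddings ((End_Q \<Lambda>)\<lparr>carrier := F\<rparr>).
      quaternion_algebra ring_of_type_algebra (\<sigma> a) (\<sigma> b) \<simeq> hamilton_quaternions"
    using quat unfolding totally_definite_quaternion_algebra_over_def by blast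
  have ab: "a \<in> F" "a \<noteq> 0" "b \<in> F" "b \<noteq> 0" using ab' by (auto simp: End_Q_ops)
  have hF: "h c = (c, 0, 0, 0)" if "c \<in> F" for c using hF' that by (simp add: End_Q_ops)
  interpret F: matrix_division_ring \<Lambda> F by (rule subfield_matrix_division_ring[OF lattice ring F])
  interpret R: ring "End_Q \<Lambda>" by (rule ring)
  interpret FR: ring "(End_Q \<Lambda>)\<lparr>carrier := F\<rparr>" by (rule R.subring_is_ring[OF subfieldE(1)[OF F]])
  define K where "K = carrier (End_Q \<Lambda>)"
  have FK: "F \<subseteq> K" using F.D_End by (simp add: K_def)
  have K_closed: "x + y \<in> K" "x ** y \<in> K" if "x \<in> K" "y \<in> K" for x y
    using R.add.m_closed[of x y] R.m_closed[of x y] that by (simp_all add: K_def End_Q_ops)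
  have F_comm: "x ** y = y ** x" if "x \<in> F" "y \<in> F" for x y
    using subfieldE(4)[OF F that] by (simp add: End_Q_ops)
  have F_diff: "x - y \<in> F" if "x \<in> F" "y \<in> F" for x y
    using F.add[OF that(1) F.neg[OF that(2)]] by simp
  note F_closed = F.zero F.one F.add F.mult F.neg F_diff ab(1,3)

  have minus: "x \<ominus>\<^bsub>(End_Q \<Lambda>)\<lparr>carrier := F\<rparr>\<^esub> y = x - y" if "x \<in> F" "y \<in> F" for x y
  proof -
    have "\<ominus>\<^bsub>(End_Q \<Lambda>)\<lparr>carrier := F\<rparr>\<^esub> y = - y"
      by (rule FR.minus_equality) (use that F.neg in \<open>auto simp: End_Q_ops\<close>)
    then show ?thesis by (simp add: a_minus_def End_Q_ops)
  qed
  have qmult: "quaternion_mult ((End_Q \<Lambda>)\<lparr>carrier := F\<rparr>) a b (x0, x1, x2, x3) (y0, y1, y2, y3) =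
      (x0 ** y0 + a ** (x1 ** y1) + b ** (x2 ** y2) - a ** b ** (x3 ** y3),
       x0 ** y1 + x1 ** y0 + b ** (x3 ** y2) - b ** (x2 ** y3),
       x0 ** y2 + x2 ** y0 + a ** (x1 ** y3) - a ** (x3 ** y1),
       x0 ** y3 + x3 ** y0 + x1 ** y2 - x2 ** y1)"
    if "x0 \<in> F" "x1 \<in> F" "x2 \<in> F" "x3 \<in> F" "y0 \<in> F" "y1 \<in> F" "y2 \<in> F" "y3 \<in> F" for x0 x1 x2 x3 y0 y1 y2 y3
    using that by (simp add: End_Q_ops minus F_closed)

  have \<sigma>_neg_op: "\<sigma> (- x) = - \<sigma> x" if "character F \<sigma>" "x \<in> F" for \<sigma> x
    using that by (rule F.character_neg)
  have \<sigma>_ops: "\<sigma> (x + y) = \<sigma> x + \<sigma> y" "\<sigma> (x ** y) = \<sigma> x * \<sigma> y" "\<sigma> (x - y) = \<sigma> x - \<sigma> y"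
    if "character F \<sigma>" "x \<in> F" "y \<in> F" for \<sigma> x y
  proof -
    have *: "\<sigma> (u + v) = \<sigma> u + \<sigma> v" if "u \<in> F" "v \<in> F" for u v
      using \<open>character F \<sigma>\<close> that by (simp add: character_def)
    show "\<sigma> (x + y) = \<sigma> x + \<sigma> y" using that(2,3) by (rule *)
    show "\<sigma> (x ** y) = \<sigma> x * \<sigma> y" using that by (simp add: character_def)
    show "\<sigma> (x - y) = \<sigma> x - \<sigma> y"
      using *[OF that(2) F.neg[OF that(3)]] \<sigma>_neg_op[OF that(1,3)] by simp
  qed
  have \<sigma>_real: "\<sigma> x \<in> \<real>" if "character F \<sigma>" "x \<in> F" for \<sigma> x
    by (rule totally_real_character[OF real that])
  have \<sigma>_inj: "x = 0" if \<sigma>: "character F \<sigma>" and x: "x \<in> F" "\<sigma> x = 0" for \<sigma> x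
  proof (rule ccontr)
    assume "x \<noteq> 0"
    then have x': "x \<in> F - {\<zero>\<^bsub>End_Q \<Lambda>\<^esub>}" using x(1) by (simp add: End_Q_ops)
    define y where "y = inv\<^bsub>End_Q \<Lambda>\<^esub> x"
    have "y \<in> F" "x ** y = mat 1"
      using R.subfield_m_inv(1,2)[OF F x'] by (simp_all add: y_def End_Q_ops)
    then have "\<sigma> (mat 1) = 0" using \<sigma>_ops(2)[OF \<sigma> x(1), of y] x(2) by simp
    then show False using \<sigma> by (simp add: character_def)
  qed
  have \<sigma>_eq: "x = y" if "character F \<sigma>" "x \<in> F" "y \<in> F" "\<sigma> x = \<sigma> y" for \<sigma> x y
    using \<sigma>_inj[OF that(1) F_diff[OF that(2,3)]] \<sigma>_ops(3)[OF that(1-3)] that(4) by simp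
  \<comment> \<open>Definiteness gives nonpositive images of a and b; they are nonzero because
    \<sigma> is injective on F.\<close>
  have \<sigma>_neg: "\<exists>r s. r < 0 \<and> s < 0 \<and> \<sigma> a = complex_of_real r \<and> \<sigma> b = complex_of_real s"
    if \<sigma>: "character F \<sigma>" for \<sigma>
  proof -
    have Re: "\<sigma> x = complex_of_real (Re (\<sigma> x))" if "x \<in> F" for x
      using \<sigma>_real[OF \<sigma> that] by (simp add: complex_is_Real_iff complex_eq_iff)
    have "Re (\<sigma> (x ** y)) = Re (\<sigma> x) * Re (\<sigma> y)" if "x \<in> F" "y \<in> F" for x y
      using \<sigma>_ops(2)[OF \<sigma> that] Re that by (metis Re_complex_of_real of_real_mult)
    then have "(\<lambda>x. Re (\<sigma> x)) \<in> real_embeddings ((End_Q \<Lambda>)\<lparr>carrier := F\<rparr>)"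
      using \<sigma> \<sigma>_ops(1)[OF \<sigma>]
      by (auto simp: real_embeddings_def ring_hom_def ring_of_type_algebra_def End_Q_ops character_def)
    from quaternion_iso_hamilton_negative[OF definite[rule_format, OF this]]
    have "Re (\<sigma> a) \<le> 0" "Re (\<sigma> b) \<le> 0" .
    moreover have "Re (\<sigma> a) \<noteq> 0" "Re (\<sigma> b) \<noteq> 0"
      using \<sigma>_inj[OF \<sigma>] ab Re[OF ab(1)] Re[OF ab(3)] by force+
    ultimately show ?thesis using Re[OF ab(1)] Re[OF ab(3)] by (intro exI[of _ "Re (\<sigma> a)"] exI[of _ "Re (\<sigma> b)"]) auto
  qed
  \<comment> \<open>Every nonzero vector is an eigenvector of \<open>mat 1\<close>, so the common
    eigenvector construction can start from it.\<close>
  have "\<exists>\<sigma>. character F \<sigma>"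
  proof -
    have "(1 :: complex ^ 'n) \<noteq> 0" "mat 1 *v (1 :: complex ^ 'n) = 1 *s 1" by simp_all
    then obtain w \<sigma> where "w \<noteq> 0" "\<forall>x\<in>F. x *v w = \<sigma> x *s w"
      using F.eigenvalue_character[OF subset_refl F_comm F.one] by blast
    then show ?thesis using F.character_of_common_eigenvector by blast
  qed
  \<comment> \<open>As \<open>\<sigma>0\<close> is injective on \<open>F\<close>, identities in \<open>F\<close> can be checked in \<open>\<complex>\<close>.\<close>
  then obtain \<sigma>0 where \<sigma>0: "character F \<sigma>0" by blast

  have h_mult: "h (x ** y) = quaternion_mult ((End_Q \<Lambda>)\<lparr>carrier := F\<rparr>) a b (h x) (h y)" if "x \<in> K" "y \<in> K" for x y
    using ring_iso_memE(2)[OF h] that by (simp add: K_def End_Q_ops quaternion_algebra_def)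
  have h_add: "h (x + y) = quaternion_add ((End_Q \<Lambda>)\<lparr>carrier := F\<rparr>) (h x) (h y)" if "x \<in> K" "y \<in> K" for x y
    using ring_iso_memE(3)[OF h] that by (simp add: K_def End_Q_ops quaternion_algebra_def)
  have h_bij: "bij_betw h K (F \<times> F \<times> F \<times> F)"
    using ring_iso_memE(5)[OF h] by (simp add: K_def quaternion_algebra_def)
  have h_inj: "x = y" if "x \<in> K" "y \<in> K" "h x = h y" for x y
    using h_bij that by (auto simp: bij_betw_def inj_on_def)

  have quadratic: "\<exists>t\<in>F. \<exists>m\<in>F. A ** A = t ** A - m \<and> (\<forall>c\<in>F. A ** c = c ** A) \<and>
      (m = 0 \<longrightarrow> A = 0) \<and> (\<exists>B. B ** A = m) \<and>
      (\<forall>\<sigma>. character F \<sigma> \<longrightarrow> (\<exists>r\<le>0. \<sigma> t * \<sigma> t - 4 * \<sigma> m = complex_of_real r))"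
    if A: "A \<in> K" for A
  proof -
    obtain x0 x1 x2 x3 where hA: "h A = (x0, x1, x2, x3)" and x: "x0 \<in> F" "x1 \<in> F" "x2 \<in> F" "x3 \<in> F"
      using bij_betwE[OF h_bij] A by (cases "h A") auto
    have "(x0, - x1, - x2, - x3) \<in> h ` K"
      using h_bij x F.neg by (auto simp: bij_betw_def)
    then obtain B where B: "B \<in> K" "h B = (x0, - x1, - x2, - x3)" by auto
    \<comment> \<open>\<open>B\<close> is the conjugate of \<open>A\<close>; \<open>t\<close> and \<open>m\<close> are its reduced trace and norm.\<close>
    define t where "t = x0 + x0"
    define m where "m = x0 ** x0 - a ** (x1 ** x1) - b ** (x2 ** x2) + a ** b ** (x3 ** x3)"
    note closed = F_closed x
    have t: "t \<in> F" and m: "m \<in> F" unfolding t_def m_def by (intro closed)+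
    have "h (A + B) = h t"
      using h_add[OF A B(1)] unfolding hF[OF t] by (simp add: hA B(2) t_def End_Q_ops)
    then have AB: "A + B = t" using h_inj K_closed(1)[OF A B(1)] t FK by blast
    note \<sigma>0_simps = \<sigma>_ops[OF \<sigma>0] \<sigma>_neg_op[OF \<sigma>0] F.character_zero[OF \<sigma>0] closed
    have "x0 ** x0 + a ** (x1 ** - x1) + b ** (x2 ** - x2) - a ** b ** (x3 ** - x3) = m"
      by (rule \<sigma>_eq[OF \<sigma>0]) (simp_all add: m_def \<sigma>0_simps)
    moreover have "x0 ** - x1 + x1 ** x0 + b ** (x3 ** - x2) - b ** (x2 ** - x3) = 0"
      by (rule \<sigma>_eq[OF \<sigma>0]) (simp_all add: \<sigma>0_simps)
    moreover have "x0 ** - x2 + x2 ** x0 + a ** (x1 ** - x3) - a ** (x3 ** - x1) = 0"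
      by (rule \<sigma>_eq[OF \<sigma>0]) (simp_all add: \<sigma>0_simps)
    moreover have "x0 ** - x3 + x3 ** x0 + x1 ** - x2 - x2 ** - x1 = 0"
      by (rule \<sigma>_eq[OF \<sigma>0]) (simp_all add: \<sigma>0_simps)
    ultimately have "h (A ** B) = h m"
      unfolding h_mult[OF A B(1)] hA B(2) hF[OF m] by (subst qmult) (simp_all add: closed)
    then have AB': "A ** B = m" using h_inj K_closed(2)[OF A B(1)] m FK by blast
    have comm: "A ** c = c ** A" if c: "c \<in> F" for c
    proof -
      have [simp]: "0 ** y = 0" "y ** 0 = 0" for y :: "complex ^ 'n ^ 'n"
        by (simp_all add: matrix_matrix_mult_def vec_eq_iff)
      have "h (A ** c) = (x0 ** c, x1 ** c, x2 ** c, x3 ** c)"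
        unfolding h_mult[OF A subsetD[OF FK c]] hA hF[OF c] by (subst qmult) (simp_all add: closed c)
      also have "\<dots> = (c ** x0, c ** x1, c ** x2, c ** x3)" using F_comm c x by simp
      also have "\<dots> = h (c ** A)"
        unfolding h_mult[OF subsetD[OF FK c] A] hA hF[OF c] by (subst qmult) (simp_all add: closed c)
      finally have "h (A ** c) = h (c ** A)" .
      then show ?thesis using h_inj K_closed(2) A subsetD[OF FK c] by blast
    qed
    \<comment> \<open>Multiplying t = A + B by A on the left gives the quadratic equation, and on
      the right it gives B A = m, the form needed to cancel A when it acts on a vector.\<close>
    have "A ** t = A ** A + m" by (simp only: AB[symmetric] matrix_add_ldistrib AB')
    then have AA: "A ** A = t ** A - m" using comm[OF t] by simp
    have "t ** A = A ** A + B ** A" 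
      unfolding AB[symmetric] by (simp add: matrix_matrix_mult_def vec_eq_iff sum.distrib distrib_right)
    then have BA: "B ** A = m" using AA by simp
    have \<sigma>_m: "\<exists>r0 r1 r2 r3 s s'. s < 0 \<and> s' < 0 \<and> \<sigma> x0 = complex_of_real r0 \<and> \<sigma> x1 = complex_of_real r1 \<and>
        \<sigma> x2 = complex_of_real r2 \<and> \<sigma> x3 = complex_of_real r3 \<and>
        \<sigma> m = complex_of_real (r0 * r0 - s * (r1 * r1) - s' * (r2 * r2) + s * s' * (r3 * r3))"
      if \<sigma>: "character F \<sigma>" for \<sigma>
    proof -
      obtain s s' where s: "s < 0" "s' < 0" "\<sigma> a = complex_of_real s" "\<sigma> b = complex_of_real s'"
        using \<sigma>_neg[OF \<sigma>] by blast
      obtain r0 r1 r2 r3 where r: "\<sigma> x0 = complex_of_real r0" "\<sigma> x1 = complex_of_real r1"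
        "\<sigma> x2 = complex_of_real r2" "\<sigma> x3 = complex_of_real r3"
        using \<sigma>_real[OF \<sigma>] x by (metis Reals_cases)
      have "\<sigma> m = complex_of_real (r0 * r0 - s * (r1 * r1) - s' * (r2 * r2) + s * s' * (r3 * r3))"
        unfolding m_def by (simp add: \<sigma>_ops[OF \<sigma>] closed r s(3,4))
      then show ?thesis using s(1,2) r by blast
    qed
    \<comment> \<open>Under \<sigma>0 the norm becomes a sum of four nonnegative terms, so all
      coordinates of A vanish.\<close>
    have "A = 0" if m0: "m = 0"
    proof -
      obtain r0 r1 r2 r3 s s' where r: "s < 0" "s' < 0" "\<sigma>0 x0 = complex_of_real r0" "\<sigma>0 x1 = complex_of_real r1"
        "\<sigma>0 x2 = complex_of_real r2" "\<sigma>0 x3 = complex_of_real r3"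
        and "\<sigma>0 m = complex_of_real (r0 * r0 - s * (r1 * r1) - s' * (r2 * r2) + s * s' * (r3 * r3))"
        using \<sigma>_m[OF \<sigma>0] by blast
      then have "r0 * r0 - s * (r1 * r1) - s' * (r2 * r2) + s * s' * (r3 * r3) = 0"
        using F.character_zero[OF \<sigma>0] m0 by (metis of_real_eq_0_iff)
      moreover have "0 \<le> r0 * r0" "0 \<le> - s * (r1 * r1)" "0 \<le> - s' * (r2 * r2)" "0 \<le> s * s' * (r3 * r3)"
        using r(1,2) by (simp_all add: zero_le_mult_iff mult_le_0_iff)
      ultimately have "r0 * r0 = 0" "- s * (r1 * r1) = 0" "- s' * (r2 * r2) = 0" "s * s' * (r3 * r3) = 0"
        by linarith+
      then have "r0 = 0" "r1 = 0" "r2 = 0" "r3 = 0" using r(1,2) by auto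
      then have "x0 = 0" "x1 = 0" "x2 = 0" "x3 = 0" using \<sigma>_inj[OF \<sigma>0] x r by auto
      then have "h A = h 0" using hA hF[OF F.zero] by simp
      then show ?thesis using h_inj[OF A, of 0] F.zero FK by blast
    qed
    moreover have "\<exists>r\<le>0. \<sigma> t * \<sigma> t - 4 * \<sigma> m = complex_of_real r" if \<sigma>: "character F \<sigma>" for \<sigma>
    proof -
      obtain r0 r1 r2 r3 s s' where r: "s < 0" "s' < 0" "\<sigma> x0 = complex_of_real r0"
        "\<sigma> m = complex_of_real (r0 * r0 - s * (r1 * r1) - s' * (r2 * r2) + s * s' * (r3 * r3))"
        using \<sigma>_m[OF \<sigma>] by blast
      have "\<sigma> t = complex_of_real r0 + complex_of_real r0"
        by (simp only: t_def \<sigma>_ops(1)[OF \<sigma> x(1) x(1)] r(3))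
      then have "\<sigma> t * \<sigma> t - 4 * \<sigma> m = complex_of_real (4 * (s * (r1 * r1) + s' * (r2 * r2) - s * s' * (r3 * r3)))"
        by (simp add: r(4) algebra_simps)
      moreover have "4 * (s * (r1 * r1) + s' * (r2 * r2) - s * s' * (r3 * r3)) \<le> 0"
      proof -
        have "s * (r1 * r1) \<le> 0" "s' * (r2 * r2) \<le> 0" "0 \<le> s * s' * (r3 * r3)"
          using r(1,2) by (simp_all add: zero_le_mult_iff mult_le_0_iff)
        then have "s * (r1 * r1) + s' * (r2 * r2) \<le> s * s' * (r3 * r3)"
          by (intro order_trans[OF add_nonpos_nonpos])
        then show ?thesis by simp
      qed
      ultimately show ?thesis by blast
    qed
    ultimately show ?thesis using t m AA BA comm by blast
  qed

  show K: "matrix_division_ring \<Lambda> (carrier (End_Q \<Lambda>))"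
    unfolding K_def[symmetric]
  proof
    show "lattice_in UNIV \<Lambda>" by (rule lattice)
    show "K \<subseteq> carrier (End_Q \<Lambda>)" by (simp add: K_def)
    show "- x \<in> K" if "x \<in> K" for x
    proof -
      have "(- mat 1) ** x = - (mat 1 ** x)" by (simp add: vec_eq_iff matrix_matrix_mult_def sum_negf)
      then have "- x = (- mat 1) ** x" by simp
      then show ?thesis using K_closed(2)[OF _ that, of "- mat 1"] F.neg[OF F.one] FK by auto
    qed
    show "v = 0" if x: "x \<in> K" "x \<noteq> 0" "x *v v = 0" for x v
    proof -
      \<comment> \<open>If x kills v, so does m = B x. As x is nonzero, m is a nonzero element of F,
        which is injective.\<close>
      obtain m B where m: "m \<in> F" "m = 0 \<longrightarrow> x = 0" "B ** x = m" using quadratic[OF x(1)] by blast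
      have "m *v v = B *v (x *v v)" using m(3) by (simp add: matrix_vector_mul_assoc)
      then have "m *v v = 0" using x(3) by simp
      then show ?thesis using F.injective[of m v] m(1,2) x(2) by blast
    qed
  qed (use K_closed FK F.zero F.one in auto)
  interpret K: matrix_division_ring \<Lambda> K using K unfolding K_def .

  show "norm_realizing F"
    unfolding norm_realizing_def K_def[symmetric]
  proof (intro ballI allI impI, elim conjE)
    fix A z and v :: "complex ^ 'n"
    assume A: "A \<in> K" "v \<noteq> 0" "A *v v = z *s v"
    obtain t m where tm: "t \<in> F" "m \<in> F" "A ** A = t ** A - m" and comm: "\<forall>c\<in>F. A ** c = c ** A"
      and disc: "\<forall>\<sigma>. character F \<sigma> \<longrightarrow> (\<exists>r\<le>0. \<sigma> t * \<sigma> t - 4 * \<sigma> m = complex_of_real r)"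
      using quadratic[OF A(1)] by blast
    have comm': "x ** y = y ** x" if "x \<in> insert A F" "y \<in> insert A F" for x y
      using that F_comm comm by auto
    have "insert A F \<subseteq> K" using A(1) FK by simp
    from K.eigenvalue_character[OF this comm' insertI1 A(2,3)]
    obtain w \<sigma> where w: "w \<noteq> 0" "\<sigma> A = z" "\<forall>x\<in>insert A F. x *v w = \<sigma> x *s w"
      by blast
    have \<sigma>: "character F \<sigma>" by (rule F.character_of_common_eigenvector[OF w(1)]) (use w(3) in auto)
    have "(z * z) *s w = (A ** A) *v w"
      using w(2,3) by (simp add: matrix_vector_mul_assoc[symmetric] vector_scalar_commute vector_smult_assoc)
    also have "\<dots> = t *v (A *v w) - m *v w"
      unfolding tm(3) by (simp add: matrix_vector_mult_diff_rdistrib matrix_vector_mul_assoc)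
    also have "\<dots> = (\<sigma> t * z - \<sigma> m) *s w"
      using w(2,3) tm(1,2) by (simp add: vector_scalar_commute vector_smult_assoc vec.scale_left_diff_distrib mult.commute)
    finally have "z * z = \<sigma> t * z - \<sigma> m" using w(1) by (metis vec.scale_right_imp_eq)
    then have "complex_of_real ((cmod z)\<^sup>2) = \<sigma> m"
      using disc \<sigma> \<sigma>_real[OF \<sigma>] tm(1,2) by (intro quadratic_root_norm) auto
    then show "\<exists>m\<in>F. \<exists>\<sigma>. character F \<sigma> \<and> \<sigma> m = complex_of_real ((cmod z)\<^sup>2)"
      using \<sigma> tm(2) by metis
  qed
qed

end

section \<open>Assembly of the eigenvalue factors\<close>

lemma subfield_prod_closed:
  fixes L :: "complex set"
  assumes "subfield L ring_of_type_algebra" "\<And>i. i \<in> I \<Longrightarrow> g i \<in> L"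
  shows "prod g I \<in> L"
proof -
  note sub = subringE[OF subfieldE(1)[OF assms(1)], unfolded ring_of_type_algebra_def, simplified]
  show ?thesis
    using assms(2) by (induction I rule: infinite_finite_induct) (simp_all add: sub)
qed

theorem theorem3:
  fixes \<Lambda> :: "(complex ^ 'n) set"
    and f :: "(complex ^ 'n) set \<Rightarrow> (complex ^ 'n) set"
    and \<gamma> :: real
    and F :: "(complex ^ 'n ^ 'n) set"
  assumes "simple_abelian_variety \<Lambda>"
    and "totally_real_field (End_Q \<Lambda>) \<or>
         (\<exists>F'. totally_definite_quaternion_algebra_over F' (End_Q \<Lambda>)) \<or>
         (\<exists>F'. CM_field_over F' (End_Q \<Lambda>))"
    and "maximal_totally_real_subfield (End_Q \<Lambda>) F"
    and "torus_endomorphism \<Lambda> f"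
    and "0 < \<gamma>"
    and "topological_entropy (torus_topology \<Lambda>) f = ereal (ln \<gamma>)"
  shows "complex_of_real \<gamma> \<in> normal_closure ((End_Q \<Lambda>)\<lparr>carrier := F\<rparr>)"
proof -
  have \<Lambda>: "lattice_in UNIV \<Lambda>"
    using assms(1) by (simp add: simple_abelian_variety_def abelian_variety_def)
  obtain A :: "complex ^ 'n ^ 'n" where A: "\<And>v. f (torus_proj \<Lambda> v) = torus_proj \<Lambda> (A *v v)"
    using torus_endomorphism_analytic_rep[OF \<Lambda> assms(4)] by blast
  have A_End: "A \<in> End_torus \<Lambda>"
    using assms(4) A by (auto simp: End_torus_def)
  then have A_End_Q: "A \<in> carrier (End_Q \<Lambda>)"
    by (auto simp: End_Q_def intro!: exI[of _ 1])

  have "ring (End_Q \<Lambda>) \<and> subfield F (End_Q \<Lambda>) \<and> matrix_division_ring \<Lambda> (carrier (End_Q \<Lambda>)) \<and>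
      norm_realizing \<Lambda> F"
    using assms(3) unfolding maximal_totally_real_subfield_def
  proof (elim disjE conjE)
    assume real: "totally_real_field (End_Q \<Lambda>)" and F: "F = carrier (End_Q \<Lambda>)"
    then have field: "Ring.field (End_Q \<Lambda>)" by (simp add: totally_real_field_def number_field_def)
    then have ring: "ring (End_Q \<Lambda>)" by (simp add: cring.axioms(1) domain.axioms(1) field.axioms(1))
    show ?thesis
      using norm_realizing_totally_real[OF \<Lambda> ring real] End_Q_field(1)[OF \<Lambda> ring field]
        field.carrier_is_subfield[OF field] ring by (simp add: F)
  next
    assume CM: "CM_field_over F (End_Q \<Lambda>)"
    then have field: "Ring.field (End_Q \<Lambda>)"
      by (simp add: CM_field_over_def totally_imaginary_field_def number_field_def)
    then have ring: "ring (End_Q \<Lambda>)" by (simp add: cring.axioms(1) domain.axioms(1) field.axioms(1))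
    show ?thesis
      using norm_realizing_CM[OF \<Lambda> ring CM] End_Q_field(1)[OF \<Lambda> ring field] CM ring
      by (simp add: CM_field_over_def)
  next
    assume quat: "totally_definite_quaternion_algebra_over F (End_Q \<Lambda>)"
    then have ring: "ring (End_Q \<Lambda>)" by (simp add: totally_definite_quaternion_algebra_over_def)
    show ?thesis
      using totally_definite_quaternion[OF \<Lambda> ring quat] quat ring
      by (simp add: totally_definite_quaternion_algebra_over_def)
  qed
  then have ring: "ring (End_Q \<Lambda>)" and F: "subfield F (End_Q \<Lambda>)"
    and K: "matrix_division_ring \<Lambda> (carrier (End_Q \<Lambda>))" and norm: "norm_realizing \<Lambda> F" by blast+
  interpret K: matrix_division_ring \<Lambda> "carrier (End_Q \<Lambda>)" by (rule K)
  interpret F: matrix_division_ring \<Lambda> F by (rule subfield_matrix_division_ring[OF \<Lambda> ring F])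

  obtain q :: "rat poly" where q: "Factorial_Ring.irreducible q" "\<And>v. poly_action A (map_poly of_rat q) v = 0"
    using K.irreducible_annihilator[OF A_End_Q] by metis
  obtain c d :: "complex ^ 'n \<Rightarrow> complex ^ 'n" and \<alpha> :: "'n \<Rightarrow> complex" where diag:
    "linear c" "linear d" "\<And>w. c (d w) = w" "\<And>v. d (c v) = v"
    "\<And>v i. c (A *v v) $ i = \<alpha> i * c v $ i" and \<alpha>: "\<And>i. \<exists>v. v \<noteq> 0 \<and> A *v v = \<alpha> i *s v"
    using diagonalizable_of_rsquarefree[OF rsquarefree_irreducible_rat_poly[OF q(1)] q(2)] by metis
  interpret E: torus_eigencoordinates \<Lambda> A c d \<alpha>
    by (rule torus_eigencoordinates.intro) (simp_all add: \<Lambda> diag)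
  have "ln \<gamma> = ln E.growth"
    using E.topological_entropy_eq[OF A] assms(6) by simp
  then have \<gamma>: "\<gamma> = E.growth" using assms(5) E.growth_ge_1 by simp

  show ?thesis
    unfolding normal_closure_def
  proof (intro InterI)
    fix L
    assume "L \<in> {L. normal_over_rat L \<and> (\<exists>\<sigma>\<in>complex_embeddings ((End_Q \<Lambda>)\<lparr>carrier := F\<rparr>).
        \<sigma> ` carrier ((End_Q \<Lambda>)\<lparr>carrier := F\<rparr>) \<subseteq> L)}"
    then obtain \<tau> where L: "normal_over_rat L" and \<tau>: "character F \<tau>" "\<tau> ` F \<subseteq> L"
      by (auto simp: complex_embeddings_iff_character)
    have L_sub: "subfield L ring_of_type_algebra" using L by (simp add: normal_over_rat_def)
    have "complex_of_real ((E.M i)\<^sup>2) \<in> L" for i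
    \<comment> \<open>A non-expanding eigenvalue contributes the factor 1; only the others need
      arithmetic information.\<close>
    proof (cases "cmod (\<alpha> i) \<le> 1")
      case True
      then show ?thesis
        using subringE(3)[OF subfieldE(1)[OF L_sub]] by (simp add: E.M_def ring_of_type_algebra_def)
    next
      case False
      obtain v where "v \<noteq> 0" "A *v v = \<alpha> i *s v" using \<alpha> by blast
      then obtain m \<sigma> where m: "m \<in> F" "character F \<sigma>" "\<sigma> m = complex_of_real ((cmod (\<alpha> i))\<^sup>2)"
        using norm A_End_Q unfolding norm_realizing_def[OF \<Lambda> ring] by blast
      have "\<sigma> m \<in> L"
        using F.character_value_in_normal[OF m(1,2) \<tau>(1) _ L] \<tau>(2) m(1) by blast
      then show ?thesis using False m(3) by (simp add: E.M_def)
    qed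
    then have "(\<Prod>i\<in>UNIV. complex_of_real ((E.M i)\<^sup>2)) \<in> L"
      by (rule subfield_prod_closed[OF L_sub])
    then show "complex_of_real \<gamma> \<in> L" by (simp add: \<gamma> E.growth_def)
  qed
qed

end
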